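(* Let $X=(X_t)_{t\in\mathbb R}$ be an RSMPR process with independent regression property (defined in the context), with $EX_t=0$ and time scaled so that $E(X_t|\mathcal F_{\le s})=e^{-(t-s)}X_s$ for $s<t$. Let $d_j=\frac{d}{dt}\gamma_{j,0}(t)\big|_{t=0^+}$ and $\delta_j=d_j/j$ for $j\ge2$, where $\gamma_{j,0}(t-s)$ is the constant term of the polynomial (in $X_s$) $E(X_t^j|\mathcal F_{\le s})$. Then: i) the stationary distribution of $X$ is infinitely divisible and its moment generating function $\varphi(y)=Ee^{yX_0}$ is given by $$\varphi(y)=\exp\Big(\sum_{j\ge2}\delta_j\frac{y^j}{j!}\Big).$$ Moreover, if $\delta_2>0$ then the numbers $\delta_j/\delta_2$, $j>2$, are the $(j-2)$-th moments of a certain probability measure $\chi$ identifiable by its moments, i.e. $$\varphi(y)=\exp\Big(\delta_2\int\frac{\exp(yx)-1-xy}{x^2}\,\chi(dx)\Big)$$ (the integrand at $x=0$ being $y^2/2$). ii) For $t>s$ the moment generating function of $X_t-\exp(-(t-s))X_s$ is equal to $$\exp\Big(\sum_{j\ge2}\delta_j\big(1-e^{-j(t-s)}\big)y^j/j!\Big).$$ Here identities between moment generating functions are understood as identities of power series in $y$.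
   Context: Let $X=(X_t)_{t\in\mathbb R}$ be a real Markov process, $\mathcal F_{\le s}=\sigma(X_r:r\le s)$; $\mu$ is the law of $X_0$, $v\in\mathbb N\cup\{\infty\}$ is the number of points in $\operatorname{supp}\mu$. Equalities between random variables are almost sure. $X$ is an SMPR process (stationary Markov process with polynomial regression) if: (a) it is stationary: $X_t\sim\mu$ for all $t$, and the conditional law of $X_{t}$ given $X_s=y$, $s<t$, depends only on $y$ and $t-s$; (b) all moments of $X_0$ are finite and $\mu$ is identifiable by its moments; (c) (totally linearly dependent, TLD) for all $0<n\le v-1$ and all distinct $s_1,\dots,s_n$ the matrix $[\operatorname{cov}(X_{s_i},X_{s_j})]$ is non-singular; (d) (mean-square continuous, MSC) for all $m,j\ge 0$ the quantity $E X_t^mX_s^j$ is a function of $|t-s|$, continuous at least at $0$; (e) for all $1\le n<v$ and $s<t$, $E(X_t^n|\mathcal F_{\le s})=Q_n(X_s,t-s)$ where $Q_n(x,\tau)=\sum_{j=0}^n\gamma_{n,j}(\tau)x^j$ is a polynomial in $x$ of degree exactly $n$; (f) for each $n<v$ the lower triangular $(n+1)\times(n+1)$ matrices $A_n(t)$ with entries $\gamma_{i,j}(t)$, $0\le j\le i\le n$, $\gamma_{0,0}=1$, are diagonalizable. Then $A_n(t)=V_n\Lambda_n(t)V_n^{-1}$ with $V_n$ lower triangular not depending on $t$ and $\Lambda_n(t)=\mathrm{diag}\{1,e^{-\alpha_1t},\dots,e^{-\alpha_nt}\}$. Consequently there are real numbers $\alpha_n$ ($\alpha_0=0$), called correlation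 indices, and monic polynomials $p_n$ with $\deg p_n=n$, $0\le n<v$, with $E(p_n(X_t)|\mathcal F_{\le s})=e^{-\alpha_n(t-s)}p_n(X_s)$ for $s<t$. The process is called regular (RSMPR) if the polynomials $p_n$ are orthogonal with respect to $\mu$. An RSMPR process has the independent regression property if for all $s<t$ and $j\ge1$ the conditional moment $E((X_t-E(X_t|\mathcal F_{\le s}))^j|\mathcal F_{\le s})$ is non-random (does not depend on $X_s$). *)

theory Defs
  imports
    "HOL-Probability.Probability"
    "HOL-Library.Extended_Nat"
    "HOL-Computational_Algebra.Polynomial"
    "HOL-Computational_Algebra.Formal_Power_Series"
    "Jordan_Normal_Form.Determinant"
begin

definition topological_support :: "real measure \<Rightarrow> real set" where
  "topological_support \<mu> = {x. \<forall>U. open U \<longrightarrow> x \<in> U \<longrightarrow> emeasure \<mu> U > 0}"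

definition support_count :: "real measure \<Rightarrow> enat" where
  "support_count \<mu> =
     (if finite (topological_support \<mu>) then enat (card (topological_support \<mu>)) else \<infinity>)"

definition finite_moments :: "real measure \<Rightarrow> bool" where
  "finite_moments \<mu> \<longleftrightarrow> (\<forall>n::nat. integrable \<mu> (\<lambda>x. x ^ n))"

definition identifiable_by_moments :: "real measure \<Rightarrow> bool" where
  "identifiable_by_moments \<mu> \<longleftrightarrow>
     finite_moments \<mu> \<and>
     (\<forall>\<nu>. real_distribution \<nu> \<longrightarrow> finite_moments \<nu> \<longrightarrow>
        (\<forall>n::nat. (\<integral>x. x ^ n \<partial>\<nu>) = (\<integral>x. x ^ n \<partial>\<mu>)) \<longrightarrow> \<nu> = \<mu>)"

definition infinitely_divisible :: "real measure \<Rightarrow> bool" where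
  "infinitely_divisible \<mu> \<longleftrightarrow>
     (\<forall>n::nat. n > 0 \<longrightarrow>
        (\<exists>\<nu>. real_distribution \<nu> \<and> (convolution \<nu> ^^ n) (return borel 0) = \<mu>))"

definition sigma_past :: "'a measure \<Rightarrow> (real \<Rightarrow> 'a \<Rightarrow> real) \<Rightarrow> real \<Rightarrow> 'a measure" where
  "sigma_past M X s =
     sigma (space M) {X r -` B \<inter> space M | r B. r \<le> s \<and> B \<in> sets borel}"

definition sigma_at :: "'a measure \<Rightarrow> (real \<Rightarrow> 'a \<Rightarrow> real) \<Rightarrow> real \<Rightarrow> 'a measure" where
  "sigma_at M X s = vimage_algebra (space M) (X s) borel"

definition real_process :: "'a measure \<Rightarrow> (real \<Rightarrow> 'a \<Rightarrow> real) \<Rightarrow> bool" where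
  "real_process M X \<longleftrightarrow> prob_space M \<and> (\<forall>t. X t \<in> borel_measurable M)"

definition markov_property :: "'a measure \<Rightarrow> (real \<Rightarrow> 'a \<Rightarrow> real) \<Rightarrow> bool" where
  "markov_property M X \<longleftrightarrow>
     (\<forall>s t. \<forall>B\<in>sets borel. s < t \<longrightarrow>
        (AE \<omega> in M.
           real_cond_exp M (sigma_past M X s) (\<lambda>\<omega>. indicator B (X t \<omega>)) \<omega> =
           real_cond_exp M (sigma_at M X s) (\<lambda>\<omega>. indicator B (X t \<omega>)) \<omega>))"

text \<open>
  The kernel \<open>\<kappa> \<tau>\<close> is a regular version of the conditional law of \<open>X (s + \<tau>)\<close> given \<open>X s\<close>;
  it is the same one for every \<open>s\<close>.
\<close>

definition stationary_process :: "'a measure \<Rightarrow> (real \<Rightarrow> 'a \<Rightarrow> real) \<Rightarrow> bool" where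
  "stationary_process M X \<longleftrightarrow>
     (\<forall>t. distr M borel (X t) = distr M borel (X 0)) \<and>
     (\<exists>\<kappa> :: real \<Rightarrow> real \<Rightarrow> real measure.
        (\<forall>\<tau>>0. \<kappa> \<tau> \<in> measurable borel (prob_algebra borel)) \<and>
        (\<forall>s t. \<forall>B\<in>sets borel. s < t \<longrightarrow>
           (AE \<omega> in M.
              real_cond_exp M (sigma_at M X s) (\<lambda>\<omega>. indicator B (X t \<omega>)) \<omega> =
              measure (\<kappa> (t - s) (X s \<omega>)) B)))"

definition covariance :: "'a measure \<Rightarrow> ('a \<Rightarrow> real) \<Rightarrow> ('a \<Rightarrow> real) \<Rightarrow> real" where
  "covariance M Y Z =
     (\<integral>\<omega>. (Y \<omega> - (\<integral>\<omega>'. Y \<omega>' \<partial>M)) * (Z \<omega> - (\<integral>\<omega>'. Z \<omega>' \<partial>M)) \<partial>M)"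

definition totally_linearly_dependent ::
    "'a measure \<Rightarrow> (real \<Rightarrow> 'a \<Rightarrow> real) \<Rightarrow> bool" where
  "totally_linearly_dependent M X \<longleftrightarrow>
     (\<forall>n (s :: nat \<Rightarrow> real).
        0 < n \<longrightarrow> enat n < support_count (distr M borel (X 0)) \<longrightarrow> inj_on s {..<n} \<longrightarrow>
        Determinant.det (Matrix.mat n n (\<lambda>(i, j). covariance M (X (s i)) (X (s j)))) \<noteq> 0)"

definition mean_square_continuous ::
    "'a measure \<Rightarrow> (real \<Rightarrow> 'a \<Rightarrow> real) \<Rightarrow> bool" where
  "mean_square_continuous M X \<longleftrightarrow>
     (\<forall>(m::nat) (j::nat). \<exists>g :: real \<Rightarrow> real.
        (\<forall>s t. (\<integral>\<omega>. X t \<omega> ^ m * X s \<omega> ^ j \<partial>M) = g \<bar>t - s\<bar>) \<and>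
        continuous (at 0 within {0..}) g)"

text \<open>
  In the following \<open>Q n \<tau>\<close> is the polynomial giving the \<open>n\<close>-th conditional moment at lag \<open>\<tau>\<close>,
  so that \<open>\<gamma>\<^sub>n\<^sub>,\<^sub>j(\<tau>) = coeff (Q n \<tau>) j\<close>.
\<close>

definition polynomial_regression ::
    "'a measure \<Rightarrow> (real \<Rightarrow> 'a \<Rightarrow> real) \<Rightarrow> (nat \<Rightarrow> real \<Rightarrow> real poly) \<Rightarrow> bool" where
  "polynomial_regression M X Q \<longleftrightarrow>
     (\<forall>\<tau>. Q 0 \<tau> = 1) \<and>
     (\<forall>n. 1 \<le> n \<longrightarrow> enat n < support_count (distr M borel (X 0)) \<longrightarrow>
        (\<forall>\<tau>>0. degree (Q n \<tau>) = n) \<and>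
        (\<forall>s t. s < t \<longrightarrow>
           (AE \<omega> in M. real_cond_exp M (sigma_past M X s) (\<lambda>\<omega>. X t \<omega> ^ n) \<omega> =
                       poly (Q n (t - s)) (X s \<omega>))))"

definition regression_matrix ::
    "(nat \<Rightarrow> real \<Rightarrow> real poly) \<Rightarrow> nat \<Rightarrow> real \<Rightarrow> real Matrix.mat" where
  "regression_matrix Q n t =
     Matrix.mat (n + 1) (n + 1) (\<lambda>(i, j). Polynomial.coeff (Q i t) j)"

definition diagonalizable_mat :: "real Matrix.mat \<Rightarrow> bool" where
  "diagonalizable_mat A \<longleftrightarrow> (\<exists>D. diagonal_mat D \<and> similar_mat A D)"

definition smpr ::
    "'a measure \<Rightarrow> (real \<Rightarrow> 'a \<Rightarrow> real) \<Rightarrow> (nat \<Rightarrow> real \<Rightarrow> real poly) \<Rightarrow> bool" where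
  "smpr M X Q \<longleftrightarrow>
     real_process M X \<and>
     markov_property M X \<and>
     stationary_process M X \<and>
     identifiable_by_moments (distr M borel (X 0)) \<and>
     totally_linearly_dependent M X \<and>
     mean_square_continuous M X \<and>
     polynomial_regression M X Q \<and>
     (\<forall>n. enat n < support_count (distr M borel (X 0)) \<longrightarrow>
        (\<forall>t>0. diagonalizable_mat (regression_matrix Q n t)))"

definition correlation_system ::
    "'a measure \<Rightarrow> (real \<Rightarrow> 'a \<Rightarrow> real) \<Rightarrow> (nat \<Rightarrow> real) \<Rightarrow> (nat \<Rightarrow> real poly) \<Rightarrow> bool" where
  "correlation_system M X \<alpha> p \<longleftrightarrow>
     \<alpha> 0 = 0 \<and>
     (\<forall>n. enat n < support_count (distr M borel (X 0)) \<longrightarrow>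
        degree (p n) = n \<and> lead_coeff (p n) = 1 \<and>
        (\<forall>s t. s < t \<longrightarrow>
           (AE \<omega> in M.
              real_cond_exp M (sigma_past M X s) (\<lambda>\<omega>. poly (p n) (X t \<omega>)) \<omega> =
              exp (- \<alpha> n * (t - s)) * poly (p n) (X s \<omega>))))"

definition rsmpr ::
    "'a measure \<Rightarrow> (real \<Rightarrow> 'a \<Rightarrow> real) \<Rightarrow> (nat \<Rightarrow> real \<Rightarrow> real poly) \<Rightarrow> bool" where
  "rsmpr M X Q \<longleftrightarrow>
     smpr M X Q \<and>
     (\<exists>\<alpha> p. correlation_system M X \<alpha> p \<and>
        (\<forall>m n. enat m < support_count (distr M borel (X 0)) \<longrightarrow>
               enat n < support_count (distr M borel (X 0)) \<longrightarrow> m \<noteq> n \<longrightarrow>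
           (\<integral>x. poly (p m) x * poly (p n) x \<partial>distr M borel (X 0)) = 0))"

definition independent_regression :: "'a measure \<Rightarrow> (real \<Rightarrow> 'a \<Rightarrow> real) \<Rightarrow> bool" where
  "independent_regression M X \<longleftrightarrow>
     (\<forall>s t (j::nat). s < t \<longrightarrow> 1 \<le> j \<longrightarrow>
        (\<exists>c. AE \<omega> in M.
           real_cond_exp M (sigma_past M X s)
             (\<lambda>\<omega>. (X t \<omega> - real_cond_exp M (sigma_past M X s) (X t) \<omega>) ^ j) \<omega> = c))"

definition integral_fps :: "real measure \<Rightarrow> (real \<Rightarrow> real fps) \<Rightarrow> real fps" where
  "integral_fps \<mu> f = Abs_fps (\<lambda>n. \<integral>x. fps_nth (f x) n \<partial>\<mu>)"

definition mgf_fps :: "real measure \<Rightarrow> real fps" where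
  "mgf_fps \<mu> = integral_fps \<mu> (\<lambda>x. fps_exp x)"

text \<open>The series in \<open>y\<close> of \<open>(exp (y x) - 1 - x y) / x\<^sup>2\<close>, with the value \<open>y\<^sup>2 / 2\<close> at \<open>x = 0\<close>.\<close>

definition levy_integrand :: "real \<Rightarrow> real fps" where
  "levy_integrand x =
     (if x = 0 then fps_const (1 / 2) * fps_X ^ 2
      else fps_const (1 / x ^ 2) * (fps_exp x - 1 - fps_const x * fps_X))"

end

theory Submission
  imports Defs "HOL-Real_Asymp.Real_Asymp"
begin

text \<open>
  By the independent regression property the innovation \<open>Y = X\<^sub>t - e\<^bsup>-(t-s)\<^esup> X\<^sub>s\<close> is, as far as moments
  are concerned, independent of \<open>X\<^sub>s\<close>, so the moment generating series factor as
  \<open>\<phi>(y) = \<phi>(e\<^bsup>-(t-s)\<^esup> y) \<psi>(y)\<close>: the stationary law \<open>\<mu>\<close> is selfdecomposable, and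
  \<open>\<psi>\<close> is determined by \<open>L = \<phi>'/\<phi>\<close>. Differentiating the coefficients of
  \<open>\<phi>(y) / \<phi>(e\<^bsup>-\<tau>\<^esup> y)\<close> at \<open>\<tau> = 0\<close> identifies \<open>\<delta>\<^sub>j\<close> with the \<open>j\<close>-th cumulant. Convolution roots of
  \<open>\<mu>\<close> come from products of rescaled innovation laws through the method of moments, and the
  Kolmogorov measure is the limit of the roots weighted by \<open>x\<^sup>2\<close>. It is determined by its moments
  because any \<open>\<nu>\<close> with the same moments produces triangular arrays whose row sums have moments
  converging to those of \<open>\<mu>\<close>; hence the characteristic function of \<open>\<mu>\<close> is
  \<open>exp (c \<integral> (e\<^bsup>itx\<^esup> - 1 - itx) / x\<^sup>2 \<nu>(dx))\<close>, and second differences in \<open>t\<close> of the exponent recover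
  the characteristic function of \<open>\<nu>\<close>.
\<close>

section \<open>Formal power series and their logarithmic derivatives\<close>

text \<open>Exponentials of series are handled through \<open>F' = L F\<close>. All series of laws
  have constant term 1, so \<open>L\<close> determines \<open>F\<close>; products add the
  \<open>L\<close>, a dilation by \<open>a\<close> multiplies the coefficient of \<open>y^i\<close>
  in \<open>L\<close> by \<open>a^(i+1)\<close>, and limits pass coefficientwise. No formal
  logarithm has to be built. Two obstacles shape the rest. The series of \<open>\<mu>\<close> need
  not converge, so it says nothing directly about the characteristic function; moments are turned
  into laws only by weak limits and by the identifiability of \<open>\<mu>\<close>. The usual
  compound Poisson approximants with jump rate \<open>c / x^2\<close> may have infinite intensity
  near 0, hence the centred two-point jumps of variance \<open>h\<close>, which tolerate
  \<open>x = 0\<close>. Secondly, a regression polynomial is determined by the conditional moment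
  only if no nonzero polynomial vanishes almost surely under \<open>\<mu>\<close>. Otherwise
  \<open>\<mu>\<close> has finite support; selfdecomposability and the zero mean then leave only the
  point mass at 0, for which the constant terms vanish anyway.\<close>

lemma fps_linear_ode_unique:
  fixes f g L :: "real fps"
  assumes "fps_deriv f = L * f" "fps_deriv g = L * g" "fps_nth f 0 = fps_nth g 0"
  shows "f = g"
proof (rule fps_ext)
  fix n show "fps_nth f n = fps_nth g n"
  proof (induction n rule: less_induct)
    case (less n)
    show ?case
    proof (cases n)
      case (Suc m)
      have "real (Suc m) * fps_nth f (Suc m) = fps_nth (L * f) m"
        using assms(1) by (metis fps_deriv_nth Suc_eq_plus1)
      also have "\<dots> = fps_nth (L * g) m"
        unfolding fps_mult_nth using less Suc by (intro sum.cong) auto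
      also have "\<dots> = real (Suc m) * fps_nth g (Suc m)"
        using assms(2) by (metis fps_deriv_nth Suc_eq_plus1)
      finally show ?thesis using Suc by simp
    qed (use assms in simp)
  qed
qed

text \<open>The coefficient of order \<open>k + 1\<close> is a fixed multiple of the
  \<open>k\<close>-th coefficient of \<open>L F\<close>, which involves only lower coefficients of
  \<open>F\<close>. So convergence of the log-derivatives, that is of the cumulants, climbs up to
  convergence of the moments.\<close>

lemma fps_linear_ode_limit:
  fixes F :: "nat \<Rightarrow> real fps" and L f l
  assumes "\<And>m. fps_deriv (F m) = L m * F m" "fps_deriv f = l * f"
    and "\<And>m. fps_nth (F m) 0 = fps_nth f 0"
    and "\<And>k. (\<lambda>m. fps_nth (L m) k) \<longlonglongrightarrow> fps_nth l k"
  shows "(\<lambda>m. fps_nth (F m) n) \<longlonglongrightarrow> fps_nth f n"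
proof (induction n rule: less_induct)
  case (less n)
  show ?case
  proof (cases n)
    case (Suc k)
    have eq: "fps_nth G (Suc k) = fps_nth (H * G) k / real (Suc k)"
      if "fps_deriv G = H * G" for G H :: "real fps"
    proof -
      have "real (Suc k) * fps_nth G (Suc k) = fps_nth (H * G) k"
        using that by (metis fps_deriv_nth Suc_eq_plus1)
      then show ?thesis by (simp add: field_simps)
    qed
    have "(\<lambda>m. fps_nth (L m * F m) k) \<longlonglongrightarrow> fps_nth (l * f) k"
      unfolding fps_mult_nth using less Suc by (intro tendsto_intros assms) auto
    then show ?thesis
      unfolding Suc eq[OF assms(1)] eq[OF assms(2)] by (intro tendsto_divide) auto
  qed (use assms in simp)
qed

lemma fps_inverse_limit:
  fixes F :: "nat \<Rightarrow> real fps"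
  assumes "\<And>m. fps_nth (F m) 0 = 1" "fps_nth f 0 = 1"
    and "\<And>k. (\<lambda>m. fps_nth (F m) k) \<longlonglongrightarrow> fps_nth f k"
  shows "(\<lambda>m. fps_nth (inverse (F m)) n) \<longlonglongrightarrow> fps_nth (inverse f) n"
proof (induction n rule: less_induct)
  case (less n)
  show ?case
  proof (cases n)
    case (Suc k)
    have eq: "fps_nth (inverse G) (Suc k) = - (\<Sum>i=0..k. fps_nth (inverse G) i * fps_nth G (Suc k - i))"
      if "fps_nth G 0 = 1" for G :: "real fps"
    proof -
      have "inverse G * G = 1" using that by (simp add: inverse_mult_eq_1)
      then have "fps_nth (inverse G * G) (Suc k) = 0" by simp
      then show ?thesis unfolding fps_mult_nth using that by simp
    qed
    show ?thesis unfolding Suc eq[OF assms(1)] eq[OF assms(2)]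
      using less Suc by (intro tendsto_intros assms) auto
  qed (use assms in simp)
qed

lemma fps_exp_compose_eqI:
  fixes f K :: "real fps"
  assumes "fps_nth f 0 = 1" "fps_nth K 0 = 0" "fps_deriv f = fps_deriv K * f"
  shows "f = fps_exp 1 oo K"
proof (rule fps_linear_ode_unique)
  show "fps_deriv (fps_exp 1 oo K) = fps_deriv K * (fps_exp 1 oo K)"
    using assms(2) by (simp add: fps_compose_deriv mult.commute)
qed (use assms in auto)

lemma fps_deriv_exp_compose:
  fixes K :: "real fps"
  assumes "fps_nth K 0 = 0"
  shows "fps_deriv (fps_exp 1 oo K) = fps_deriv K * (fps_exp 1 oo K)"
  using assms by (simp add: fps_compose_deriv mult.commute)

lemma fps_log_deriv:
  fixes f :: "real fps"
  assumes "fps_nth f 0 = 1"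
  shows "fps_deriv f = (fps_deriv f * inverse f) * f"
  using assms by (simp add: mult.assoc inverse_mult_eq_1)

lemma fps_nth_power_0_one: "fps_nth f 0 = (1::real) \<Longrightarrow> fps_nth (f ^ n) 0 = 1"
  by (simp add: fps_power_zeroth)

lemma fps_nth_scale: "fps_nth (f oo (fps_const a * fps_X)) n = (a::real) ^ n * fps_nth f n"
  by (simp add: fps_compose_linear)

lemma fps_scale_ode:
  fixes f L :: "real fps"
  assumes "fps_deriv f = L * f"
  shows "fps_deriv (f oo (fps_const a * fps_X)) =
     (fps_const a * (L oo (fps_const a * fps_X))) * (f oo (fps_const a * fps_X))"
  by (subst fps_compose_deriv) (use assms in \<open>auto simp: fps_compose_mult_distrib algebra_simps\<close>)

lemma fps_mult_ode:
  fixes f g :: "real fps"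
  assumes "fps_deriv f = L * f" "fps_deriv g = N * g"
  shows "fps_deriv (f * g) = (L + N) * (f * g)"
  using assms by (simp add: algebra_simps)

lemma fps_power_ode:
  fixes f L :: "real fps"
  assumes "fps_deriv f = L * f"
  shows "fps_deriv (f ^ n) = (fps_const (real n) * L) * f ^ n"
proof (induction n)
  case (Suc n)
  have c: "fps_const (real (Suc n)) = 1 + fps_const (real n)"
    by (simp add: fps_eq_iff)
  show ?case unfolding power_Suc c using fps_mult_ode[OF assms Suc] by (simp add: algebra_simps)
qed simp

section \<open>Moment generating series and convolution\<close>

definition moment_law :: "real measure \<Rightarrow> bool" where
  "moment_law M \<longleftrightarrow> real_distribution M \<and> finite_moments M"

lemma moment_lawD:
  assumes "moment_law M"
  shows "real_distribution M" "finite_moments M" "prob_space M" "integrable M (\<lambda>x. x ^ n)"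
    "sets M = sets borel"
  using assms
  by (auto simp: moment_law_def finite_moments_def real_distribution_def
      real_distribution.events_eq_borel)

lemma moment_law_distr:
  assumes "prob_space M" "X \<in> borel_measurable M" "\<And>n. integrable M (\<lambda>x. X x ^ n)"
  shows "moment_law (distr M borel X)"
  using assms
  by (auto simp: moment_law_def finite_moments_def integrable_distr_eq
      intro!: prob_space.real_distribution_distr)

lemma fps_nth_mgf: "fps_nth (mgf_fps M) n = (\<integral>x. x ^ n \<partial>M) / fact n"
  by (simp add: mgf_fps_def integral_fps_def)

lemma moment_mgf: "(\<integral>x. x ^ n \<partial>M) = fact n * fps_nth (mgf_fps M) n"
  by (simp add: fps_nth_mgf)

lemma mgf_nth_0: "prob_space M \<Longrightarrow> fps_nth (mgf_fps M) 0 = 1"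
  by (simp add: fps_nth_mgf prob_space.prob_space)

text \<open>The single gate through which identities of series become equalities of
  measures.\<close>

lemma identifiable_mgf_eqI:
  assumes "identifiable_by_moments \<mu>" "moment_law \<nu>" "mgf_fps \<nu> = mgf_fps \<mu>"
  shows "\<nu> = \<mu>"
  using assms unfolding identifiable_by_moments_def moment_law_def
  by (metis moment_mgf)

lemma (in pair_sigma_finite)
  fixes f :: "'a \<Rightarrow> 'c::{real_normed_field,banach,second_countable_topology}"
  assumes "integrable M1 f" "integrable M2 g"
  shows integrable_pair_mult: "integrable (M1 \<Otimes>\<^sub>M M2) (\<lambda>p. f (fst p) * g (snd p))"
    and integral_pair_mult:
      "(\<integral>p. f (fst p) * g (snd p) \<partial>(M1 \<Otimes>\<^sub>M M2)) = (\<integral>x. f x \<partial>M1) * (\<integral>x. g x \<partial>M2)"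
proof -
  have [measurable]: "f \<in> borel_measurable M1" "g \<in> borel_measurable M2"
    using assms by auto
  show *: "integrable (M1 \<Otimes>\<^sub>M M2) (\<lambda>p. f (fst p) * g (snd p))"
    using assms by (intro Fubini_integrable) (auto simp: norm_mult)
  show "(\<integral>p. f (fst p) * g (snd p) \<partial>(M1 \<Otimes>\<^sub>M M2)) = (\<integral>x. f x \<partial>M1) * (\<integral>x. g x \<partial>M2)"
    by (subst integral_fst'[OF *, symmetric]) simp
qed

lemma moment_law_return: "moment_law (return borel a)"
  unfolding moment_law_def finite_moments_def
  by (auto simp: real_distribution_def real_distribution_axioms_def intro!: prob_space_return
      integrableI_bounded) (auto simp: nn_integral_return)

lemma mgf_return_0: "mgf_fps (return borel 0) = 1"
  by (rule fps_ext) (auto simp: fps_nth_mgf integral_return power_0_left)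

lemma char_return_0: "char (return borel 0) t = 1"
  by (simp add: char_def integral_return)

context
  fixes A B :: "real measure"
  assumes A: "moment_law A" and B: "moment_law B"
begin

interpretation A: real_distribution A using A by (rule moment_lawD)
interpretation B: real_distribution B using B by (rule moment_lawD)
interpretation P: pair_prob_space A B ..

lemma measurable_add_pair: "(\<lambda>(x, y). x + y) \<in> borel_measurable (A \<Otimes>\<^sub>M B)"
  by measurable

lemma integrable_pair_monom: "integrable (A \<Otimes>\<^sub>M B) (\<lambda>p. fst p ^ i * snd p ^ j)"
  by (intro P.integrable_pair_mult moment_lawD A B)

lemma integral_pair_monom:
  "(\<integral>p. fst p ^ i * snd p ^ j \<partial>(A \<Otimes>\<^sub>M B)) = (\<integral>x. x ^ i \<partial>A) * (\<integral>x. x ^ j \<partial>B)"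
  by (intro P.integral_pair_mult moment_lawD A B)

lemma moment_law_convolution: "moment_law (A \<star> B)"
  unfolding convolution_def
proof (rule moment_law_distr)
  show "prob_space (A \<Otimes>\<^sub>M B)" by (rule P.prob_space_axioms)
  show "(\<lambda>(x, y). x + y) \<in> borel_measurable (A \<Otimes>\<^sub>M B)" by (rule measurable_add_pair)
  show "integrable (A \<Otimes>\<^sub>M B) (\<lambda>x. (case x of (x, y) \<Rightarrow> x + y) ^ n)" for n
    by (simp add: split_beta' binomial_ring mult.assoc integrable_pair_monom)
qed

lemma mgf_convolution: "mgf_fps (A \<star> B) = mgf_fps A * mgf_fps B"
proof (rule fps_ext)
  fix n
  have "(\<integral>x. x ^ n \<partial>(A \<star> B)) = (\<integral>p. (fst p + snd p) ^ n \<partial>(A \<Otimes>\<^sub>M B))"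
    unfolding convolution_def by (subst integral_distr) (auto simp: split_beta')
  also have "\<dots> = (\<Sum>k\<le>n. real (n choose k) * ((\<integral>x. x ^ k \<partial>A) * (\<integral>x. x ^ (n - k) \<partial>B)))"
    by (simp add: binomial_ring mult.assoc integrable_pair_monom integral_pair_monom)
  finally have "fps_nth (mgf_fps (A \<star> B)) n =
      (\<Sum>k\<le>n. real (n choose k) / fact n * ((\<integral>x. x ^ k \<partial>A) * (\<integral>x. x ^ (n - k) \<partial>B)))"
    by (simp add: fps_nth_mgf sum_divide_distrib)
  also have "\<dots> = fps_nth (mgf_fps A * mgf_fps B) n"
    unfolding fps_mult_nth fps_nth_mgf atLeast0AtMost
    by (intro sum.cong) (auto simp: binomial_fact)
  finally show "fps_nth (mgf_fps (A \<star> B)) n = fps_nth (mgf_fps A * mgf_fps B) n" .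
qed

lemma char_convolution: "char (A \<star> B) t = char A t * char B t"
proof -
  have "char (A \<star> B) t = (\<integral>p. iexp (t * fst p) * iexp (t * snd p) \<partial>(A \<Otimes>\<^sub>M B))"
    unfolding convolution_def char_def
    by (subst integral_distr) (auto simp: split_beta' exp_add[symmetric] algebra_simps)
  also have "\<dots> = char A t * char B t"
    unfolding char_def
    by (intro P.integral_pair_mult A.integrable_const_bound[of _ 1] B.integrable_const_bound[of _ 1]) auto
  finally show ?thesis .
qed

end

lemma
  assumes "moment_law A"
  shows moment_law_convolution_power: "moment_law (((\<star>) A ^^ n) (return borel 0))"
    and mgf_convolution_power: "mgf_fps (((\<star>) A ^^ n) (return borel 0)) = mgf_fps A ^ n"
    and char_convolution_power: "char (((\<star>) A ^^ n) (return borel 0)) t = char A t ^ n"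
proof -
  have *: "moment_law (((\<star>) A ^^ n) (return borel 0))" for n
    by (induction n) (auto intro: moment_law_return moment_law_convolution assms)
  show "moment_law (((\<star>) A ^^ n) (return borel 0))" by (rule *)
  show "mgf_fps (((\<star>) A ^^ n) (return borel 0)) = mgf_fps A ^ n"
    by (induction n) (auto simp: mgf_return_0 mgf_convolution[OF assms *])
  show "char (((\<star>) A ^^ n) (return borel 0)) t = char A t ^ n"
    by (induction n) (auto simp: char_return_0 char_convolution[OF assms *])
qed

lemma
  assumes "moment_law A"
  shows moment_law_scale: "moment_law (distr A borel ((*) a))"
    and mgf_scale: "mgf_fps (distr A borel ((*) a)) = mgf_fps A oo (fps_const a * fps_X)"
proof -
  have s: "sets A = sets borel" using assms by (rule moment_lawD)
  have m: "(*) a \<in> borel_measurable A" unfolding measurable_cong_sets[OF s refl] by simp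
  show "moment_law (distr A borel ((*) a))"
    using assms by (intro moment_law_distr m) (auto intro: moment_lawD simp: power_mult_distrib)
  show "mgf_fps (distr A borel ((*) a)) = mgf_fps A oo (fps_const a * fps_X)"
    by (rule fps_ext, subst fps_nth_scale)
      (auto simp: fps_nth_mgf integral_distr[OF m] power_mult_distrib)
qed

section \<open>The method of moments\<close>

text \<open>The second moments give tightness, and moments of order \<open>2 k\<close>
  control the error of truncation in moments of order \<open>k\<close>.\<close>

definition clamp_real :: "real \<Rightarrow> real \<Rightarrow> real" where
  "clamp_real R x = max (- R) (min R x)"

lemma clamp_real_bounds:
  assumes "0 \<le> R"
  shows "\<bar>clamp_real R x\<bar> \<le> R" "\<bar>clamp_real R x\<bar> \<le> \<bar>x\<bar>"
  using assms by (auto simp: clamp_real_def max_def min_def)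

lemma isCont_clamp_real: "isCont (\<lambda>x. clamp_real R x ^ k) x"
  unfolding clamp_real_def by (intro continuous_intros)

lemma measurable_clamp_real [measurable]: "(\<lambda>x. clamp_real R x ^ k) \<in> borel_measurable borel"
  unfolding clamp_real_def by measurable

text \<open>Outside \<open>[-R, R]\<close> both powers are at most \<open>\<bar>x\<bar>^k\<close> in
  absolute value, and \<open>R \<le> \<bar>x\<bar>^k\<close> there; this buys the factor
  \<open>1 / R\<close> at the price of a doubled exponent.\<close>

lemma clamp_real_error:
  assumes "1 \<le> R" "1 \<le> k"
  shows "\<bar>x ^ k - clamp_real R x ^ k\<bar> \<le> 2 / R * x ^ (2 * k)"
proof (cases "\<bar>x\<bar> \<le> R")
  case True
  then have "clamp_real R x = x" by (auto simp: clamp_real_def)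
  then show ?thesis using assms by simp
next
  case False
  have 1: "R \<le> \<bar>x\<bar> ^ k" using False assms
    by (metis linorder_not_le order.trans less_imp_le self_le_power One_nat_def Suc_le_eq)
  have "\<bar>x ^ k - clamp_real R x ^ k\<bar> \<le> \<bar>x\<bar> ^ k + \<bar>clamp_real R x\<bar> ^ k"
    by (metis abs_triangle_ineq4 power_abs)
  also have "\<dots> \<le> \<bar>x\<bar> ^ k + \<bar>x\<bar> ^ k"
    using assms by (intro add_left_mono power_mono clamp_real_bounds) auto
  also have "\<dots> = 2 / R * (R * \<bar>x\<bar> ^ k)" using assms by simp
  also have "\<dots> \<le> 2 / R * (\<bar>x\<bar> ^ k * \<bar>x\<bar> ^ k)"
    using assms 1 by (intro mult_left_mono mult_right_mono) auto
  also have "\<bar>x\<bar> ^ k * \<bar>x\<bar> ^ k = x ^ (2 * k)"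
    by (simp add: mult_2 power_add abs_mult[symmetric] power_abs[symmetric])
  finally show ?thesis .
qed

lemma clamp_real_tendsto: "(\<lambda>n. clamp_real (real n) x) \<longlonglongrightarrow> x"
proof (rule tendsto_eventually)
  have "eventually (\<lambda>n. \<bar>x\<bar> \<le> real n) sequentially"
    by (meson eventually_sequentiallyI of_nat_mono order_trans real_nat_ceiling_ge)
  then show "\<forall>\<^sub>F n in sequentially. clamp_real (real n) x = x"
    by eventually_elim (auto simp: clamp_real_def)
qed

lemma tight_if_moments_convergent:
  assumes M: "\<And>n. moment_law (M n)"
    and lim: "(\<lambda>n. \<integral>x. x ^ 2 \<partial>M n) \<longlonglongrightarrow> m"
  shows "tight M"
  unfolding tight_def
proof (intro conjI allI impI)
  fix e :: real assume e: "0 < e"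
  interpret M: real_distribution "M n" for n using M by (rule moment_lawD)
  obtain B where B: "\<And>n. (\<integral>x. x ^ 2 \<partial>M n) \<le> B" "0 < B"
  proof -
    from convergent_imp_Bseq[of "\<lambda>n. \<integral>x. x ^ 2 \<partial>M n"] lim obtain B where
      "B > 0" "\<forall>n. norm (\<integral>x. x ^ 2 \<partial>M n) \<le> B" by (auto simp: convergent_def Bseq_def)
    then show ?thesis by (intro that[of B]) (auto simp: abs_le_iff)
  qed
  \<comment> \<open>Chebyshev with this \<open>a\<close> leaves mass at most
    \<open>B / a^2 = e / 2\<close> outside, strictly below \<open>e\<close> as \<open>tight\<close>
    demands.\<close>
  define a where "a = sqrt (2 * B / e)"
  have a: "0 < a" "a\<^sup>2 = 2 * B / e" using B e by (auto simp: a_def)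
  have "measure (M n) {- a<..a} > 1 - e" for n
  proof -
    have "measure (M n) {x \<in> space (M n). a\<^sup>2 \<le> x\<^sup>2} \<le> (\<integral>x. x ^ 2 \<partial>M n) / a\<^sup>2"
      using a(1) by (intro integral_Markov_inequality_measure[where A = "{}"] moment_lawD M) auto
    also have "\<dots> \<le> B / a\<^sup>2" by (intro divide_right_mono B zero_le_power2)
    also have "\<dots> < e" using a B e by (simp add: field_simps)
    finally have "measure (M n) {x \<in> space (M n). a\<^sup>2 \<le> x\<^sup>2} < e" .
    moreover have "measure (M n) (UNIV - {- a<..a}) \<le> measure (M n) {x \<in> space (M n). a\<^sup>2 \<le> x\<^sup>2}"
      using a(1) by (intro M.finite_measure_mono) (auto simp: abs_le_square_iff[symmetric])
    ultimately show ?thesis using M.prob_compl[of "{- a<..a}" n] by simp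
  qed
  then show "\<exists>b c. b < c \<and> (\<forall>n. 1 - e < measure (M n) {b<..c})"
    using a(1) by (intro exI[of _ "- a"] exI[of _ a]) auto
qed (use M in \<open>auto intro: moment_lawD\<close>)

text \<open>Nothing ensures that \<open>m\<close> determines a law, so the limit is reached along a
  subsequence only. Callers either want just some law with these moments or add identifiability; the
  weak convergence is kept for characteristic functions.\<close>

lemma method_of_moments:
  assumes M: "\<And>n. moment_law (M n)"
    and lim: "\<And>k. (\<lambda>n. \<integral>x. x ^ k \<partial>M n) \<longlonglongrightarrow> m k"
  obtains r \<nu> where "strict_mono r" "moment_law \<nu>" "weak_conv_m (M \<circ> r) \<nu>"
    "\<And>k. (\<integral>x. x ^ k \<partial>\<nu>) = m k"
proof -
  from tight_imp_convergent_subsubsequence[OF tight_if_moments_convergent[OF M lim] strict_mono_id]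
  obtain r \<nu> where r: "strict_mono r" and \<nu>: "real_distribution \<nu>" and w: "weak_conv_m (M \<circ> r) \<nu>"
    by (auto simp: comp_def)
  interpret \<nu>: real_distribution \<nu> by fact
  interpret M: real_distribution "M n" for n using M by (rule moment_lawD)
  have limr: "(\<lambda>n. \<integral>x. x ^ k \<partial>M (r n)) \<longlonglongrightarrow> m k" for k
    using LIMSEQ_subseq_LIMSEQ[OF lim r] by (simp add: comp_def)
  have cbound: "\<bar>clamp_real R x ^ k\<bar> \<le> R ^ k" if "0 \<le> R" for R k x
    using clamp_real_bounds(1)[OF that] by (auto simp: power_abs intro!: power_mono)
  have clim: "(\<lambda>n. \<integral>x. clamp_real R x ^ k \<partial>M (r n)) \<longlonglongrightarrow> (\<integral>x. clamp_real R x ^ k \<partial>\<nu>)"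
    if "0 \<le> R" for R k
    using weak_conv_imp_integral_bdd_continuous_conv[of "\<lambda>n. M (r n)" \<nu> "\<lambda>x. clamp_real R x ^ k" "R ^ k"]
      w \<nu> M.real_distribution_axioms isCont_clamp_real cbound[OF that]
    by (auto simp: comp_def)
  have cint: "integrable N (\<lambda>x. clamp_real R x ^ k)" if "real_distribution N" "0 \<le> R" for R k N
  proof -
    interpret N: real_distribution N by fact
    show ?thesis using cbound[OF that(2)] by (intro N.integrable_const_bound[of _ "R ^ k"]) auto
  qed
  have even_le: "(\<integral>x. clamp_real R x ^ (2 * k) \<partial>\<nu>) \<le> m (2 * k)" if "0 \<le> R" for R k
  proof (rule LIMSEQ_le[OF clim limr])
    have "clamp_real R x ^ (2 * k) \<le> x ^ (2 * k)" for x
      using power_mono[OF clamp_real_bounds(2)[OF that, of x], of "2 * k"]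
      by (simp add: power_even_abs)
    then have "(\<integral>x. clamp_real R x ^ (2 * k) \<partial>M (r n)) \<le> (\<integral>x. x ^ (2 * k) \<partial>M (r n))" for n
      by (intro integral_mono cint moment_lawD M that M.real_distribution_axioms)
    then show "\<exists>N. \<forall>n\<ge>N. (\<integral>x. clamp_real R x ^ (2 * k) \<partial>M (r n)) \<le> (\<integral>x. x ^ (2 * k) \<partial>M (r n))"
      by blast
  qed fact
  \<comment> \<open>Fatou over growing clamp levels makes the even moments of the limit finite; the
    odd ones and the exact values come only afterwards.\<close>
  have even: "integrable \<nu> (\<lambda>x. x ^ (2 * k)) \<and> (\<integral>x. x ^ (2 * k) \<partial>\<nu>) \<le> m (2 * k)" for k
  proof -
    have "(\<integral>\<^sup>+x. ennreal (x ^ (2 * k)) \<partial>\<nu>) =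
        (\<integral>\<^sup>+x. liminf (\<lambda>n. ennreal (clamp_real (real n) x ^ (2 * k))) \<partial>\<nu>)"
      by (intro nn_integral_cong lim_imp_Liminf[symmetric] tendsto_ennrealI tendsto_power clamp_real_tendsto) auto
    also have "\<dots> \<le> liminf (\<lambda>n. \<integral>\<^sup>+x. ennreal (clamp_real (real n) x ^ (2 * k)) \<partial>\<nu>)"
      by (intro nn_integral_liminf) measurable
    also have "\<dots> \<le> ennreal (m (2 * k))"
    proof (intro Liminf_le always_eventually allI)
      fix n
      have "(\<integral>\<^sup>+x. ennreal (clamp_real (real n) x ^ (2 * k)) \<partial>\<nu>) =
          ennreal (\<integral>x. clamp_real (real n) x ^ (2 * k) \<partial>\<nu>)"
        by (intro nn_integral_eq_integral cint \<nu>) (auto simp: power_mult)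
      also have "\<dots> \<le> ennreal (m (2 * k))" by (intro ennreal_leI even_le) auto
      finally show "(\<integral>\<^sup>+x. ennreal (clamp_real (real n) x ^ (2 * k)) \<partial>\<nu>) \<le> ennreal (m (2 * k))" .
    qed auto
    finally have le: "(\<integral>\<^sup>+x. ennreal (x ^ (2 * k)) \<partial>\<nu>) \<le> ennreal (m (2 * k))" .
    have m0: "0 \<le> m (2 * k)"
      by (rule LIMSEQ_le_const[OF limr]) (auto simp: power_mult)
    have "(\<integral>\<^sup>+x. ennreal (x ^ (2 * k)) \<partial>\<nu>) < \<infinity>"
      using le by (simp add: order_le_less_trans)
    then have i: "integrable \<nu> (\<lambda>x. x ^ (2 * k))"
      by (intro integrableI_bounded) (auto simp: power_mult)
    moreover have "(\<integral>x. x ^ (2 * k) \<partial>\<nu>) \<le> m (2 * k)"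
      using le m0 nn_integral_eq_integral[OF i] by (auto simp: power_mult)
    ultimately show ?thesis ..
  qed
  have int: "integrable \<nu> (\<lambda>x. x ^ k)" for k
  proof (rule Bochner_Integration.integrable_bound[of \<nu> "\<lambda>x. 1 + x ^ (2 * k)"])
    show "integrable \<nu> (\<lambda>x. 1 + x ^ (2 * k))" using even by (intro Bochner_Integration.integrable_add) auto
    have b: "\<bar>y\<bar> \<le> 1 + y\<^sup>2" for y :: real
    proof -
      have "0 \<le> (\<bar>y\<bar> - 1)\<^sup>2" "0 \<le> \<bar>y\<bar>" by simp_all
      then show ?thesis by (simp add: power2_diff)
    qed
    have "norm (x ^ k) \<le> norm (1 + x ^ (2 * k))" for x :: real
      using b[of "x ^ k"] by (simp add: power_mult[symmetric] mult.commute)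
    then show "AE x in \<nu>. norm (x ^ k) \<le> norm (1 + x ^ (2 * k))"
      by simp
  qed auto
  have "(\<integral>x. x ^ k \<partial>\<nu>) = m k" for k
  proof (cases "k = 0")
    case True
    have "(\<lambda>n. 1) \<longlonglongrightarrow> m 0" using limr[of 0] by (simp add: M.prob_space del: M.space_eq_univ)
    then have "m 0 = 1" by (simp add: LIMSEQ_const_iff)
    then show ?thesis using True by (simp add: \<nu>.prob_space del: \<nu>.space_eq_univ)
  next
    case False
    have err: "\<bar>(\<integral>x. x ^ k \<partial>N) - (\<integral>x. clamp_real R x ^ k \<partial>N)\<bar> \<le> 2 / R * (\<integral>x. x ^ (2 * k) \<partial>N)"
      if "1 \<le> R" "moment_law N" for N R
    proof -
      have "(\<integral>x. x ^ k \<partial>N) - (\<integral>x. clamp_real R x ^ k \<partial>N) = (\<integral>x. x ^ k - clamp_real R x ^ k \<partial>N)"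
        using that by (intro Bochner_Integration.integral_diff[symmetric] cint moment_lawD) auto
      also have "\<bar>\<dots>\<bar> \<le> (\<integral>x. \<bar>x ^ k - clamp_real R x ^ k\<bar> \<partial>N)"
        using integral_norm_bound[of N "\<lambda>x. x ^ k - clamp_real R x ^ k"] by simp
      also have "\<dots> \<le> (\<integral>x. 2 / R * x ^ (2 * k) \<partial>N)"
        using that False
        by (intro integral_mono integrable_abs Bochner_Integration.integrable_diff cint moment_lawD
            integrable_mult_right clamp_real_error) auto
      finally show ?thesis by simp
    qed
    have \<nu>m: "moment_law \<nu>" using int \<nu> by (auto simp: moment_law_def finite_moments_def)
    \<comment> \<open>The clamped integral links both sides: one error \<open>2 m(2k) / R\<close>
      comes from the prelimit laws, an equal one from \<open>\<nu>\<close>.\<close>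
    have bound: "\<bar>(\<integral>x. x ^ k \<partial>\<nu>) - m k\<bar> \<le> 4 * m (2 * k) / R" if "1 \<le> R" for R
    proof -
      have "\<bar>m k - (\<integral>x. clamp_real R x ^ k \<partial>\<nu>)\<bar> \<le> 2 / R * m (2 * k)"
      proof (rule LIMSEQ_le)
        show "(\<lambda>n. \<bar>(\<integral>x. x ^ k \<partial>M (r n)) - (\<integral>x. clamp_real R x ^ k \<partial>M (r n))\<bar>)
            \<longlonglongrightarrow> \<bar>m k - (\<integral>x. clamp_real R x ^ k \<partial>\<nu>)\<bar>"
          using that by (intro tendsto_intros limr clim) auto
        show "(\<lambda>n. 2 / R * (\<integral>x. x ^ (2 * k) \<partial>M (r n))) \<longlonglongrightarrow> 2 / R * m (2 * k)"
          by (intro tendsto_intros limr)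
        show "\<exists>N. \<forall>n\<ge>N. \<bar>(\<integral>x. x ^ k \<partial>M (r n)) - (\<integral>x. clamp_real R x ^ k \<partial>M (r n))\<bar>
            \<le> 2 / R * (\<integral>x. x ^ (2 * k) \<partial>M (r n))"
          using err[OF that M] by blast
      qed
      moreover have "2 / R * (\<integral>x. x ^ (2 * k) \<partial>\<nu>) \<le> 2 / R * m (2 * k)"
        using that even by (intro mult_left_mono) auto
      ultimately show ?thesis using err[OF that \<nu>m] by (simp add: abs_le_iff)
    qed
    have "\<bar>(\<integral>x. x ^ k \<partial>\<nu>) - m k\<bar> \<le> 0"
    proof (rule LIMSEQ_le_const[of "\<lambda>n. 4 * m (2 * k) / real n"])
      show "(\<lambda>n. 4 * m (2 * k) / real n) \<longlonglongrightarrow> 0" by (rule lim_const_over_n)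
      show "\<exists>N. \<forall>n\<ge>N. \<bar>(\<integral>x. x ^ k \<partial>\<nu>) - m k\<bar> \<le> 4 * m (2 * k) / real n"
        using bound by (intro exI[of _ 1]) auto
    qed
    then show ?thesis by simp
  qed
  then show ?thesis
    using that[OF r _ w] int \<nu> by (auto simp: moment_law_def finite_moments_def)
qed

section \<open>Triangular arrays of two-point jumps\<close>

text \<open>The coin choosing between \<open>a x\<close> and \<open>b x\<close> is a density on the
  product with the counting measure on \<open>bool\<close>, so that integrals reduce to Fubini and
  no kernel has to be composed.\<close>

definition two_point_mixture ::
    "real measure \<Rightarrow> (real \<Rightarrow> real) \<Rightarrow> (real \<Rightarrow> real) \<Rightarrow> (real \<Rightarrow> real) \<Rightarrow> real measure" where
  "two_point_mixture \<nu> p a b =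
     distr (density (\<nu> \<Otimes>\<^sub>M count_space (UNIV :: bool set))
         (\<lambda>z. ennreal (if snd z then p (fst z) else 1 - p (fst z))))
       borel (\<lambda>z. if snd z then a (fst z) else b (fst z))"

context
  fixes \<nu> :: "real measure" and p a b :: "real \<Rightarrow> real"
  assumes \<nu>: "real_distribution \<nu>"
    and [measurable]: "p \<in> borel_measurable borel" "a \<in> borel_measurable borel" "b \<in> borel_measurable borel"
    and p: "\<And>x. 0 \<le> p x" "\<And>x. p x \<le> 1"
begin

interpretation \<nu>: real_distribution \<nu> by (rule \<nu>)
interpretation B: sigma_finite_measure "count_space (UNIV :: bool set)"
  by (rule sigma_finite_measure_count_space_finite) simp
interpretation P: pair_sigma_finite \<nu> "count_space (UNIV :: bool set)" ..

lemma real_distribution_two_point_mixture: "real_distribution (two_point_mixture \<nu> p a b)"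
proof -
  let ?N = "\<nu> \<Otimes>\<^sub>M count_space (UNIV :: bool set)"
  let ?w = "\<lambda>z. if snd z then p (fst z) else 1 - p (fst z)"
  have "emeasure (density ?N (\<lambda>z. ennreal (?w z))) (space ?N) = (\<integral>\<^sup>+z. ennreal (?w z) \<partial>?N)"
    by (subst emeasure_density) (auto intro!: nn_integral_cong simp: indicator_def)
  also have "\<dots> = (\<integral>\<^sup>+x. \<integral>\<^sup>+c. ennreal (?w (x, c)) \<partial>count_space UNIV \<partial>\<nu>)"
    by (rule B.nn_integral_fst[symmetric]) measurable
  also have "\<dots> = (\<integral>\<^sup>+x. 1 \<partial>\<nu>)"
  proof (intro nn_integral_cong)
    fix x
    have "ennreal (p x) + ennreal (1 - p x) = 1"
      using p[of x] by (subst ennreal_plus[symmetric]) auto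
    then show "(\<integral>\<^sup>+c. ennreal (?w (x, c)) \<partial>count_space UNIV) = 1"
      by (simp add: nn_integral_count_space_finite UNIV_bool add.commute)
  qed
  also have "\<dots> = 1" using \<nu>.emeasure_space_1 by simp
  finally interpret D: prob_space "density ?N (\<lambda>z. ennreal (?w z))"
    by (intro prob_spaceI) simp
  show ?thesis
    unfolding two_point_mixture_def by (intro D.real_distribution_distr) measurable
qed

lemma
  fixes f :: "real \<Rightarrow> 'b::{banach, second_countable_topology}"
  assumes [measurable]: "f \<in> borel_measurable borel"
    and f: "integrable \<nu> (\<lambda>x. p x *\<^sub>R f (a x))" "integrable \<nu> (\<lambda>x. (1 - p x) *\<^sub>R f (b x))"
  shows integrable_two_point_mixture: "integrable (two_point_mixture \<nu> p a b) f"
    and integral_two_point_mixture: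
      "(\<integral>x. f x \<partial>two_point_mixture \<nu> p a b) = (\<integral>x. p x *\<^sub>R f (a x) + (1 - p x) *\<^sub>R f (b x) \<partial>\<nu>)"
proof -
  let ?N = "\<nu> \<Otimes>\<^sub>M count_space (UNIV :: bool set)"
  let ?w = "\<lambda>z. if snd z then p (fst z) else 1 - p (fst z)"
  let ?f = "\<lambda>z. ?w z *\<^sub>R f (if snd z then a (fst z) else b (fst z))"
  have wf: "(\<lambda>z. if snd z then a (fst z) else b (fst z)) \<in> borel_measurable ?N" by measurable
  have w0: "AE z in ?N. 0 \<le> ?w z" using p by auto
  have int: "integrable ?N ?f"
  proof (rule P.Fubini_integrable)
    show "?f \<in> borel_measurable ?N" by measurable
    have "integrable \<nu> (\<lambda>x. norm (p x *\<^sub>R f (a x)) + norm ((1 - p x) *\<^sub>R f (b x)))"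
      by (rule Bochner_Integration.integrable_add[OF integrable_norm[OF f(1)] integrable_norm[OF f(2)]])
    then show "integrable \<nu> (\<lambda>x. \<integral>c. norm (?f (x, c)) \<partial>count_space UNIV)"
      by (simp add: lebesgue_integral_count_space_finite UNIV_bool add.commute)
  qed (simp add: integrable_count_space)
  show "integrable (two_point_mixture \<nu> p a b) f"
    unfolding two_point_mixture_def using w0 int
    by (subst integrable_distr_eq, measurable) (subst integrable_density, auto)
  have "(\<integral>x. f x \<partial>two_point_mixture \<nu> p a b) = (\<integral>z. ?f z \<partial>?N)"
    unfolding two_point_mixture_def using w0
    by (subst integral_distr, measurable) (subst integral_density, auto)
  also have "\<dots> = (\<integral>x. \<integral>c. ?f (x, c) \<partial>count_space UNIV \<partial>\<nu>)"
    by (rule P.integral_fst'[OF int, symmetric])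
  also have "\<dots> = (\<integral>x. p x *\<^sub>R f (a x) + (1 - p x) *\<^sub>R f (b x) \<partial>\<nu>)"
    by (intro Bochner_Integration.integral_cong)
      (auto simp: lebesgue_integral_count_space_finite UNIV_bool add.commute)
  finally show "(\<integral>x. f x \<partial>two_point_mixture \<nu> p a b) = (\<integral>x. p x *\<^sub>R f (a x) + (1 - p x) *\<^sub>R f (b x) \<partial>\<nu>)" .
qed

end

text \<open>The roots \<open>u > 0 > v\<close> of \<open>z\<^sup>2 = x z + h\<close> carry a centred two-point law of variance \<open>h\<close>
  whose moments satisfy \<open>m\<^sub>k\<^sub>+\<^sub>2 = x m\<^sub>k\<^sub>+\<^sub>1 + h m\<^sub>k\<close>, hence \<open>m\<^sub>k\<^sub>+\<^sub>2 = h x\<^sup>k + O(h\<^sup>2)\<close>.\<close>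

definition jump_up :: "real \<Rightarrow> real \<Rightarrow> real" where
  "jump_up h x = (x + sqrt (x\<^sup>2 + 4 * h)) / 2"

definition jump_down :: "real \<Rightarrow> real \<Rightarrow> real" where
  "jump_down h x = (x - sqrt (x\<^sup>2 + 4 * h)) / 2"

definition jump_weight :: "real \<Rightarrow> real \<Rightarrow> real" where
  "jump_weight h x = - jump_down h x / (jump_up h x - jump_down h x)"

text \<open>These are the moments of the two-point law from order 2 on, divided by \<open>h\<close>:
  the starting values 1 and \<open>x\<close> stand for orders 2 and 3. For \<open>h = 0\<close> the
  recurrence gives \<open>x^k\<close>.\<close>

fun jump_moment :: "real \<Rightarrow> real \<Rightarrow> nat \<Rightarrow> real" where
  "jump_moment h x 0 = 1"
| "jump_moment h x (Suc 0) = x"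
| "jump_moment h x (Suc (Suc k)) = x * jump_moment h x (Suc k) + h * jump_moment h x k"

lemma measurable_jump [measurable]:
  "jump_up h \<in> borel_measurable borel" "jump_down h \<in> borel_measurable borel"
  "jump_weight h \<in> borel_measurable borel"
proof -
  show *[measurable]: "jump_up h \<in> borel_measurable borel" "jump_down h \<in> borel_measurable borel"
    unfolding jump_up_def[abs_def] jump_down_def[abs_def] by measurable
  show "jump_weight h \<in> borel_measurable borel"
    unfolding jump_weight_def[abs_def] by measurable
qed

context
  fixes h :: real
  assumes h: "0 < h"
begin

lemma abs_less_sqrt_jump: "\<bar>x\<bar> < sqrt (x\<^sup>2 + 4 * h)"
  using h by (intro real_less_rsqrt) auto

lemma jump_signs: "0 < jump_up h x" "jump_down h x < 0"
  using abs_less_sqrt_jump[of x] by (auto simp: jump_up_def jump_down_def)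

lemma jump_diff_pos: "0 < jump_up h x - jump_down h x"
  using jump_signs[of x] by simp

lemma jump_prod: "jump_up h x * jump_down h x = - h"
proof -
  have "(sqrt (x\<^sup>2 + 4 * h))\<^sup>2 = x\<^sup>2 + 4 * h" using h by (intro real_sqrt_pow2) auto
  then show ?thesis unfolding jump_up_def jump_down_def
    by (simp add: field_simps power2_eq_square)
qed

lemma jump_sum: "jump_up h x + jump_down h x = x"
  by (simp add: jump_up_def jump_down_def field_simps)

lemma jump_quadratic:
  "jump_up h x * jump_up h x = x * jump_up h x + h"
  "jump_down h x * jump_down h x = x * jump_down h x + h"
proof -
  have eq: "y * y = (y + z) * y - y * z" for y z :: real by (simp add: algebra_simps)
  show "jump_up h x * jump_up h x = x * jump_up h x + h"
    unfolding eq[of _ "jump_down h x"] jump_sum jump_prod by simp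
  show "jump_down h x * jump_down h x = x * jump_down h x + h"
    unfolding eq[of _ "jump_up h x"] add.commute[of "jump_down h x"] mult.commute[of "jump_down h x" "jump_up h x"]
      jump_sum jump_prod by simp
qed

lemma jump_weight_bounds: "0 \<le> jump_weight h x" "jump_weight h x \<le> 1"
proof -
  show "0 \<le> jump_weight h x" unfolding jump_weight_def
    using jump_signs[of x] by (intro divide_nonneg_nonneg) auto
  show "jump_weight h x \<le> 1" unfolding jump_weight_def
    using jump_signs[of x] by (subst divide_le_eq_1_pos) auto
qed

lemma jump_weight_compl: "1 - jump_weight h x = jump_up h x / (jump_up h x - jump_down h x)"
  using jump_diff_pos[of x] by (simp add: jump_weight_def field_simps)

lemma jump_mean: "jump_weight h x * jump_up h x + (1 - jump_weight h x) * jump_down h x = 0"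
  unfolding jump_weight_compl by (simp add: jump_weight_def)

lemma jump_moment_eq:
  "jump_weight h x * jump_up h x ^ (k + 2) + (1 - jump_weight h x) * jump_down h x ^ (k + 2) =
     h * jump_moment h x k"
proof -
  define w u v where "w = jump_weight h x" and "u = jump_up h x" and "v = jump_down h x"
  have q: "u * u = x * u + h" "v * v = x * v + h" and m: "w * u + (1 - w) * v = 0"
    unfolding u_def v_def w_def by (rule jump_quadratic jump_mean)+
  have rec: "w * u ^ Suc (Suc k) + (1 - w) * v ^ Suc (Suc k) =
      x * (w * u ^ Suc k + (1 - w) * v ^ Suc k) + h * (w * u ^ k + (1 - w) * v ^ k)" for k
  proof -
    have "u ^ Suc (Suc k) = (x * u + h) * u ^ k" "v ^ Suc (Suc k) = (x * v + h) * v ^ k"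
      by (simp_all only: power_Suc mult.assoc[symmetric] q)
    then show ?thesis by (simp add: algebra_simps)
  qed
  have r0: "w * u ^ Suc (Suc 0) + (1 - w) * v ^ Suc (Suc 0) = h"
    unfolding rec using m by simp
  have r1: "w * u ^ Suc (Suc (Suc 0)) + (1 - w) * v ^ Suc (Suc (Suc 0)) = h * x"
    unfolding rec[of "Suc 0"] r0 using m by simp
  have "w * u ^ Suc (Suc k) + (1 - w) * v ^ Suc (Suc k) = h * jump_moment h x k"
  proof (induction k rule: induct_nat_012)
    case 0
    show ?case using r0 by simp
  next
    case 1
    show ?case using r1 by simp
  next
    case (ge2 n)
    show ?case unfolding rec[of "Suc (Suc n)"] ge2 by (simp add: algebra_simps)
  qed
  then show ?thesis by (simp add: w_def u_def v_def)
qed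

lemma abs_jump_le:
  "\<bar>jump_up h x\<bar> \<le> \<bar>x\<bar> + sqrt h" "\<bar>jump_down h x\<bar> \<le> \<bar>x\<bar> + sqrt h"
proof -
  have "sqrt (x\<^sup>2 + 4 * h) \<le> \<bar>x\<bar> + 2 * sqrt h"
  proof (rule real_le_lsqrt)
    show "x\<^sup>2 + 4 * h \<le> (\<bar>x\<bar> + 2 * sqrt h)\<^sup>2"
      using h by (simp add: power2_sum power_mult_distrib)
  qed (use h in simp)
  then show "\<bar>jump_up h x\<bar> \<le> \<bar>x\<bar> + sqrt h" "\<bar>jump_down h x\<bar> \<le> \<bar>x\<bar> + sqrt h"
    unfolding jump_up_def jump_down_def add_divide_distrib diff_divide_distrib
    using abs_less_sqrt_jump[of x] by - linarith+
qed

end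

text \<open>The kernel of the Kolmogorov representation, the function counterpart of
  \<open>levy_integrand\<close> at \<open>y = i t\<close>, extended continuously to
  \<open>x = 0\<close>.\<close>

definition levy_char :: "real \<Rightarrow> real \<Rightarrow> complex" where
  "levy_char t x = (if x = 0 then - (complex_of_real t)\<^sup>2 / 2
     else (iexp (t * x) - 1 - \<i> * (t * x)) / (complex_of_real x)\<^sup>2)"

lemma levy_char_mult: "levy_char t x * (complex_of_real x)\<^sup>2 = iexp (t * x) - 1 - \<i> * (t * x)"
  by (simp add: levy_char_def)

lemma measurable_levy_char [measurable]: "levy_char t \<in> borel_measurable borel"
  unfolding levy_char_def[abs_def] by measurable

lemma norm_levy_char_le: "norm (levy_char t x) \<le> t\<^sup>2 / 2"
proof (cases "x = 0")
  case False
  have "norm (iexp (t * x) - (1 + \<i> * (t * x))) \<le> \<bar>t * x\<bar> ^ 2 / 2"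
    using iexp_approx1[of "t * x" "Suc 0"] by (simp add: power2_eq_square)
  then have "norm (iexp (t * x) - 1 - \<i> * (t * x)) \<le> (t * x)\<^sup>2 / 2"
    by (simp add: diff_diff_eq)
  then show ?thesis using False
    by (simp add: levy_char_def norm_divide norm_power field_simps)
qed (simp add: levy_char_def norm_divide norm_power)

text \<open>Taylor's formula of second order with remainder \<open>\<bar>t x\<bar>^3 / 6\<close>,
  divided by \<open>x^2\<close>. In \<open>x\<close> it yields continuity at 0; in \<open>t\<close>
  its cubic rate later beats a division by \<open>h^2\<close>.\<close>

lemma levy_char_near_0: "norm (levy_char t x + (complex_of_real t)\<^sup>2 / 2) \<le> \<bar>t\<bar> ^ 3 / 6 * \<bar>x\<bar>"
proof (cases "x = 0")
  case False
  have "norm (iexp (t * x) - (1 + \<i> * (t * x) + (\<i> * (t * x))\<^sup>2 / 2)) \<le> \<bar>t * x\<bar> ^ 3 / 6"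
  proof -
    have 1: "(\<Sum>k\<le>Suc (Suc 0). z ^ k / fact k) = 1 + z + z\<^sup>2 / 2" for z :: complex
      by (simp add: power2_eq_square)
    have 2: "fact (Suc (Suc (Suc 0))) = (6::real)" by simp
    have 3: "Suc (Suc (Suc 0)) = 3" by simp
    show ?thesis
      using iexp_approx1[of "t * x" "Suc (Suc 0)"] unfolding 1 2 unfolding 3 .
  qed
  also have "iexp (t * x) - (1 + \<i> * (t * x) + (\<i> * (t * x))\<^sup>2 / 2) =
      (levy_char t x + (complex_of_real t)\<^sup>2 / 2) * (complex_of_real x)\<^sup>2"
    unfolding distrib_right levy_char_mult by (simp add: power_mult_distrib)
  also have "norm \<dots> = norm (levy_char t x + (complex_of_real t)\<^sup>2 / 2) * \<bar>x\<bar>\<^sup>2"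
    by (simp only: norm_mult norm_power norm_of_real)
  also have "\<bar>t * x\<bar> ^ 3 / 6 = (\<bar>t\<bar> ^ 3 / 6 * \<bar>x\<bar>) * \<bar>x\<bar>\<^sup>2"
  proof -
    have "(a * b) ^ 3 / 6 = (a ^ 3 / 6 * b) * b\<^sup>2" for a b :: real
      by (simp add: power2_eq_square power3_eq_cube)
    then show ?thesis by (simp only: abs_mult)
  qed
  finally have "norm (levy_char t x + (complex_of_real t)\<^sup>2 / 2) * \<bar>x\<bar>\<^sup>2 \<le> (\<bar>t\<bar> ^ 3 / 6 * \<bar>x\<bar>) * \<bar>x\<bar>\<^sup>2" .
  then show ?thesis using False by (subst (asm) mult_le_cancel_right) auto
qed (simp add: levy_char_def)

lemma isCont_levy_char: "isCont (levy_char t) x"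
proof (cases "x = 0")
  case True
  have "((\<lambda>y. levy_char t y + (complex_of_real t)\<^sup>2 / 2) \<longlongrightarrow> 0) (at 0)"
  proof (rule Lim_null_comparison[OF always_eventually[OF allI[OF levy_char_near_0]]])
    show "((\<lambda>y. \<bar>t\<bar> ^ 3 / 6 * \<bar>y\<bar>) \<longlongrightarrow> 0) (at (0::real))"
      by (intro tendsto_eq_intros) auto
  qed
  then have "((\<lambda>y. levy_char t y + (complex_of_real t)\<^sup>2 / 2 - (complex_of_real t)\<^sup>2 / 2)
      \<longlongrightarrow> 0 - (complex_of_real t)\<^sup>2 / 2) (at 0)"
    by (intro tendsto_intros)
  then show ?thesis using True by (simp add: isCont_def levy_char_def[of t 0])
next
  case False
  have "isCont (\<lambda>x. (iexp (t * x) - 1 - \<i> * (t * x)) / (complex_of_real x)\<^sup>2) x"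
    using False by (intro continuous_intros) auto
  moreover have "\<forall>\<^sub>F y in nhds x. levy_char t y = (iexp (t * y) - 1 - \<i> * (t * y)) / (complex_of_real y)\<^sup>2"
    using t1_space_nhds[OF False] by eventually_elim (simp add: levy_char_def)
  ultimately show ?thesis by (subst isCont_cong)
qed

text \<open>The formal version of \<open>(1 + K/n + o(1/n))^n\<close> tending to
  \<open>exp K\<close>: the log-derivative of the power is \<open>(n + 1) F' / F\<close>, whose
  numerator tends to \<open>K'\<close> and whose denominator tends to 1.\<close>

lemma fps_power_limit:
  fixes F :: "nat \<Rightarrow> real fps"
  assumes "\<And>n. fps_nth (F n) 0 = 1" "fps_nth K 0 = 0"
    and lim: "\<And>k. (\<lambda>n. real (Suc n) * fps_nth (F n) (Suc k)) \<longlonglongrightarrow> fps_nth K (Suc k)"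
  shows "(\<lambda>n. fps_nth (F n ^ Suc n) k) \<longlonglongrightarrow> fps_nth (fps_exp 1 oo K) k"
proof -
  define L where "L n = fps_const (real (Suc n)) * (fps_deriv (F n) * inverse (F n))" for n
  have F1: "(\<lambda>n. fps_nth (F n) k) \<longlonglongrightarrow> fps_nth 1 k" for k
  proof (cases k)
    case (Suc j)
    have "(\<lambda>n. real (Suc n) * fps_nth (F n) (Suc j) * inverse (real (Suc n))) \<longlonglongrightarrow> fps_nth K (Suc j) * 0"
      by (intro tendsto_mult lim LIMSEQ_inverse_real_of_nat)
    moreover have "real (Suc n) * y * inverse (real (Suc n)) = y" for n y
      by (simp del: of_nat_Suc)
    ultimately show ?thesis using Suc by (simp del: of_nat_Suc)
  qed (use assms in simp)
  have Fd: "(\<lambda>n. real (Suc n) * fps_nth (fps_deriv (F n)) k) \<longlonglongrightarrow> fps_nth (fps_deriv K) k" for k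
    using tendsto_mult_left[OF lim[of k], of "real (Suc k)"] by (simp add: algebra_simps)
  show ?thesis
  proof (rule fps_linear_ode_limit)
    show "fps_deriv (F n ^ Suc n) = L n * F n ^ Suc n" for n
      unfolding L_def by (rule fps_power_ode fps_log_deriv assms)+
    show "fps_deriv (fps_exp 1 oo K) = fps_deriv K * (fps_exp 1 oo K)"
      by (rule fps_deriv_exp_compose) fact
    show "fps_nth (F n ^ Suc n) 0 = fps_nth (fps_exp 1 oo K) 0" for n
      using assms by (subst fps_nth_power_0_one) auto
    show "(\<lambda>n. fps_nth (L n) k) \<longlonglongrightarrow> fps_nth (fps_deriv K) k" for k
    proof -
      have "(\<lambda>n. fps_nth (fps_const (real (Suc n)) * fps_deriv (F n) * inverse (F n)) k)
          \<longlonglongrightarrow> fps_nth (fps_deriv K * inverse 1) k"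
        unfolding fps_mult_nth[of "fps_const _ * _"] fps_mult_nth[of "fps_deriv K"] fps_mult_left_const_nth
        by (intro tendsto_sum tendsto_mult Fd fps_inverse_limit F1 assms) auto
      then show ?thesis by (simp add: L_def mult.assoc)
    qed
  qed
qed

text \<open>The powers are compared with those of \<open>w n = exp (a / (n + 1))\<close>, which
  equal \<open>exp a\<close> exactly. In the unit disc powers differ by at most the exponent times
  the distance of the bases, so no complex logarithm enters.\<close>

lemma complex_power_limit:
  fixes z :: "nat \<Rightarrow> complex"
  assumes z: "\<And>n. norm (z n) \<le> 1"
    and lim: "(\<lambda>n. of_nat (Suc n) * (z n - 1)) \<longlonglongrightarrow> a"
  shows "(\<lambda>n. z n ^ Suc n) \<longlonglongrightarrow> exp a"
proof -
  define w where "w n = exp (a / of_nat (Suc n))" for n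
  \<comment> \<open>\<open>Re a \<le> 0\<close> is inherited from the \<open>z n\<close> lying in
    the unit disc; it puts the \<open>w n\<close> into the disc too, as
    \<open>norm_power_diff\<close> requires.\<close>
  have "Re (of_nat (Suc n) * (z n - 1)) \<le> 0" for n
    using complex_Re_le_cmod[of "z n"] z[of n] by (auto simp: mult_le_0_iff simp del: of_nat_Suc)
  then have "Re a \<le> 0"
    by (intro LIMSEQ_le_const2[OF tendsto_Re[OF lim]]) auto
  then have w: "norm (w n) \<le> 1" for n
    by (simp add: w_def divide_le_0_iff del: of_nat_Suc)
  have wpow: "w n ^ Suc n = exp a" for n
    unfolding w_def exp_of_nat_mult[symmetric] by (simp del: of_nat_Suc)
  have "((\<lambda>h. exp (a * h)) has_field_derivative a) (at 0)"
    by (auto intro!: derivative_eq_intros)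
  then have d: "((\<lambda>h. (exp (a * h) - 1) / h) \<longlongrightarrow> a) (at 0)"
    by (simp add: DERIV_def)
  have "filterlim (\<lambda>n. inverse (of_nat (Suc n)) :: complex) (at 0) sequentially"
    unfolding filterlim_at using LIMSEQ_Suc[OF lim_inverse_n, where 'a1 = complex] by (simp del: of_nat_Suc)
  from filterlim_compose[OF d this]
  have wl: "(\<lambda>n. of_nat (Suc n) * (w n - 1)) \<longlonglongrightarrow> a"
    by (simp add: w_def field_simps del: of_nat_Suc)
  have "(\<lambda>n. z n ^ Suc n - exp a) \<longlonglongrightarrow> 0"
  proof (rule Lim_null_comparison)
    show "\<forall>\<^sub>F n in sequentially. norm (z n ^ Suc n - exp a) \<le>
        norm (of_nat (Suc n) * (z n - 1) - of_nat (Suc n) * (w n - 1))"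
    proof (intro always_eventually allI)
      fix n
      have "norm (z n ^ Suc n - exp a) \<le> real (Suc n) * norm (z n - w n)"
        unfolding wpow[of n, symmetric] by (rule norm_power_diff[OF z w])
      also have "\<dots> = norm (of_nat (Suc n) * (z n - w n))"
        by (simp only: norm_mult norm_of_nat)
      also have "of_nat (Suc n) * (z n - w n) = of_nat (Suc n) * (z n - 1) - of_nat (Suc n) * (w n - 1)"
        by (simp add: algebra_simps del: of_nat_Suc)
      finally show "norm (z n ^ Suc n - exp a) \<le>
        norm (of_nat (Suc n) * (z n - 1) - of_nat (Suc n) * (w n - 1))" .
    qed
    show "(\<lambda>n. norm (of_nat (Suc n) * (z n - 1) - of_nat (Suc n) * (w n - 1))) \<longlonglongrightarrow> 0"
      using tendsto_norm[OF tendsto_diff[OF lim wl]] by simp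
  qed
  then show ?thesis by (simp add: LIM_zero_iff)
qed

text \<open>Centring cancels the linear terms, and \<open>u v = - h\<close> turns
  \<open>w u^2\<close> into \<open>h (1 - w)\<close> and \<open>(1 - w) v^2\<close> into
  \<open>h w\<close>. The result is \<open>h\<close> times a convex combination of the kernel at the
  two jumps, with the weights exchanged.\<close>

lemma jump_char:
  fixes h t x :: real
  assumes h: "0 < h"
  defines "w \<equiv> complex_of_real (jump_weight h x)"
  shows "w * iexp (t * jump_up h x) + (1 - w) * iexp (t * jump_down h x) - 1 =
     h * ((1 - w) * levy_char t (jump_up h x) + w * levy_char t (jump_down h x))"
proof -
  define u v d where "u = jump_up h x" and "v = jump_down h x" and "d = u - v"
  have "1 - w = of_real (1 - jump_weight h x)" by (simp add: w_def)
  then have d: "w = of_real (- v / d)" "1 - w = of_real (u / d)"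
    unfolding jump_weight_compl[OF h] unfolding w_def d_def u_def v_def jump_weight_def by blast+
  have uv: "u * v = - h" unfolding u_def v_def by (rule jump_prod[OF h])
  have m: "w * of_real u + (1 - w) * of_real v = 0"
  proof -
    have "w * of_real u + (1 - w) * of_real v =
        of_real (jump_weight h x * jump_up h x + (1 - jump_weight h x) * jump_down h x)"
      by (simp add: w_def u_def v_def)
    then show ?thesis unfolding jump_mean[OF h] by simp
  qed
  have "w * (of_real u)\<^sup>2 = of_real (- (u * v) * u / d)"
    unfolding d by (simp add: power2_eq_square)
  also have "\<dots> = h * (1 - w)" unfolding uv d(2) by simp
  finally have wu: "w * (of_real u)\<^sup>2 = h * (1 - w)" .
  have "(1 - w) * (of_real v)\<^sup>2 = of_real ((u * v) * v / d)"
    unfolding d(2) by (simp add: power2_eq_square)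
  also have "\<dots> = h * w" unfolding uv d(1) by simp
  finally have wv: "(1 - w) * (of_real v)\<^sup>2 = h * w" .
  have "w * iexp (t * u) + (1 - w) * iexp (t * v) - 1 =
      w * (iexp (t * u) - 1 - \<i> * (t * u)) + (1 - w) * (iexp (t * v) - 1 - \<i> * (t * v))
      + \<i> * t * (w * of_real u + (1 - w) * of_real v)"
    by (simp add: algebra_simps)
  also have "\<dots> = (w * (of_real u)\<^sup>2) * levy_char t u + ((1 - w) * (of_real v)\<^sup>2) * levy_char t v"
    unfolding m levy_char_mult[symmetric] by (simp only: mult_ac mult_zero_right mult_zero_left add_0_right)
  finally show ?thesis unfolding wu wv by (simp add: algebra_simps u_def v_def)
qed

text \<open>As \<open>h\<close> tends to 0 the jumps tend to the positive and negative part of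
  \<open>x\<close>, and the exchanged weights concentrate on the one that equals \<open>x\<close>.
  At \<open>x = 0\<close> the weight stays \<open>1 / 2\<close>, but both jumps tend to 0.\<close>

lemma jump_levy_limit:
  assumes h: "\<And>n. 0 < h n" "h \<longlonglongrightarrow> 0"
  shows "(\<lambda>n. (1 - complex_of_real (jump_weight (h n) x)) * levy_char t (jump_up (h n) x) +
       jump_weight (h n) x * levy_char t (jump_down (h n) x)) \<longlonglongrightarrow> levy_char t x"
proof -
  have s: "(\<lambda>n. sqrt (x\<^sup>2 + 4 * h n)) \<longlonglongrightarrow> \<bar>x\<bar>"
  proof -
    have "(\<lambda>n. sqrt (x\<^sup>2 + 4 * h n)) \<longlonglongrightarrow> sqrt (x\<^sup>2 + 4 * 0)"
      by (intro tendsto_intros h)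
    then show ?thesis by simp
  qed
  have u: "(\<lambda>n. jump_up (h n) x) \<longlonglongrightarrow> (x + \<bar>x\<bar>) / 2"
    unfolding jump_up_def by (intro tendsto_intros s) auto
  have v: "(\<lambda>n. jump_down (h n) x) \<longlonglongrightarrow> (x - \<bar>x\<bar>) / 2"
    unfolding jump_down_def by (intro tendsto_intros s) auto
  obtain l where w: "(\<lambda>n. jump_weight (h n) x) \<longlonglongrightarrow> l"
    and l: "0 < x \<Longrightarrow> l = 0" "x < 0 \<Longrightarrow> l = 1"
  proof (cases "x = 0")
    case True
    have "(\<lambda>n. jump_weight (h n) x) = (\<lambda>_. 1 / 2)"
    proof
      fix n show "jump_weight (h n) x = 1 / 2"
        using h(1)[of n] True by (simp add: jump_weight_def jump_up_def jump_down_def)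
    qed
    then show ?thesis using that[of "1 / 2"] True by simp
  next
    case False
    have "(\<lambda>n. jump_weight (h n) x) \<longlonglongrightarrow> - ((x - \<bar>x\<bar>) / 2) / ((x + \<bar>x\<bar>) / 2 - (x - \<bar>x\<bar>) / 2)"
      unfolding jump_weight_def using False by (intro tendsto_intros u v) (auto simp: field_simps)
    then show ?thesis by (rule that) (use False in \<open>auto simp: abs_if\<close>)
  qed
  have "(\<lambda>n. (1 - complex_of_real (jump_weight (h n) x)) * levy_char t (jump_up (h n) x) +
       jump_weight (h n) x * levy_char t (jump_down (h n) x)) \<longlonglongrightarrow>
     (1 - complex_of_real l) * levy_char t ((x + \<bar>x\<bar>) / 2) + l * levy_char t ((x - \<bar>x\<bar>) / 2)"
    by (intro tendsto_intros w isCont_tendsto_compose[OF isCont_levy_char] u v)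
  also have "(1 - complex_of_real l) * levy_char t ((x + \<bar>x\<bar>) / 2) + l * levy_char t ((x - \<bar>x\<bar>) / 2) = levy_char t x"
    using l by (cases x "0 :: real" rule: linorder_cases) (auto simp: algebra_simps)
  finally show ?thesis .
qed

text \<open>The free factor \<open>x^i\<close> makes the induction work: the recurrence trades index
  \<open>k + 2\<close> for \<open>k + 1\<close> at the cost of one more factor
  \<open>x\<close>.\<close>

lemma jump_moment_integrable:
  assumes "moment_law \<nu>"
  shows "integrable \<nu> (\<lambda>x. x ^ i * jump_moment h x k)"
proof (induction k arbitrary: i rule: induct_nat_012)
  case 0
  then show ?case using assms by (auto intro: moment_lawD)
next
  case 1
  then show ?case using moment_lawD(4)[OF assms, of "Suc i"] by (simp add: mult.commute)
next
  case (ge2 k)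
  have "integrable \<nu> (\<lambda>x. x ^ Suc i * jump_moment h x (Suc k) + h * (x ^ i * jump_moment h x k))"
    by (intro Bochner_Integration.integrable_add integrable_mult_right ge2)
  then show ?case by (simp add: algebra_simps)
qed

text \<open>The recurrence is integrated term by term; the term carrying \<open>h n\<close> dies
  out, and a dominating function is avoided.\<close>

lemma jump_moment_limit:
  assumes \<nu>: "moment_law \<nu>" and h: "h \<longlonglongrightarrow> 0"
  shows "(\<lambda>n. \<integral>x. x ^ i * jump_moment (h n) x k \<partial>\<nu>) \<longlonglongrightarrow> (\<integral>x. x ^ (i + k) \<partial>\<nu>)"
proof (induction k arbitrary: i rule: induct_nat_012)
  case 1
  then show ?case by (simp add: mult.commute)
next
  case (ge2 k)
  have eq: "(\<integral>x. x ^ i * jump_moment (h n) x (Suc (Suc k)) \<partial>\<nu>) =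
      (\<integral>x. x ^ Suc i * jump_moment (h n) x (Suc k) \<partial>\<nu>) + h n * (\<integral>x. x ^ i * jump_moment (h n) x k \<partial>\<nu>)" for n
  proof -
    have "(\<integral>x. x ^ i * jump_moment (h n) x (Suc (Suc k)) \<partial>\<nu>) =
      (\<integral>x. x ^ Suc i * jump_moment (h n) x (Suc k) + h n * (x ^ i * jump_moment (h n) x k) \<partial>\<nu>)"
      by (simp add: algebra_simps)
    also have "\<dots> = (\<integral>x. x ^ Suc i * jump_moment (h n) x (Suc k) \<partial>\<nu>) + h n * (\<integral>x. x ^ i * jump_moment (h n) x k \<partial>\<nu>)"
      by (subst Bochner_Integration.integral_add)
        (auto intro!: integrable_mult_right jump_moment_integrable \<nu> simp del: power_Suc)
    finally show ?thesis .
  qed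
  have "(\<lambda>n. (\<integral>x. x ^ Suc i * jump_moment (h n) x (Suc k) \<partial>\<nu>) + h n * (\<integral>x. x ^ i * jump_moment (h n) x k \<partial>\<nu>))
      \<longlonglongrightarrow> (\<integral>x. x ^ (Suc i + Suc k) \<partial>\<nu>) + 0 * (\<integral>x. x ^ (i + k) \<partial>\<nu>)"
    by (intro tendsto_intros ge2 h)
  then show ?case unfolding eq by simp
qed simp

definition jump_law :: "real \<Rightarrow> real measure \<Rightarrow> real measure" where
  "jump_law h \<nu> = two_point_mixture \<nu> (jump_weight h) (jump_up h) (jump_down h)"

lemma moment_law_integrable_shift:
  assumes "moment_law \<nu>"
  shows "integrable \<nu> (\<lambda>x. (\<bar>x\<bar> + c) ^ n)"
proof -
  have "integrable \<nu> (\<lambda>x. \<bar>x\<bar> ^ k)" for k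
    using integrable_abs[OF moment_lawD(4)[OF assms, of k]] by (simp add: power_abs)
  then show ?thesis by (simp add: binomial_ring)
qed

context
  fixes h :: real and \<nu> :: "real measure"
  assumes h: "0 < h" and \<nu>: "moment_law \<nu>"
begin

interpretation real_distribution \<nu> using \<nu> by (rule moment_lawD)

lemma jump_law_integrable_aux:
  "integrable \<nu> (\<lambda>x. jump_weight h x *\<^sub>R jump_up h x ^ n)"
  "integrable \<nu> (\<lambda>x. (1 - jump_weight h x) *\<^sub>R jump_down h x ^ n)"
proof -
  have b: "\<bar>p * y\<bar> \<le> (\<bar>x\<bar> + sqrt h) ^ n" if "0 \<le> p" "p \<le> 1" "\<bar>y\<bar> \<le> (\<bar>x\<bar> + sqrt h) ^ n" for p x y :: real
    using mult_mono[OF that(2,3)] that by (simp add: abs_mult)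
  have i: "integrable \<nu> (\<lambda>x. (\<bar>x\<bar> + sqrt h) ^ n)"
    by (rule moment_law_integrable_shift[OF \<nu>])
  have u: "\<bar>jump_up h x ^ n\<bar> \<le> (\<bar>x\<bar> + sqrt h) ^ n" "\<bar>jump_down h x ^ n\<bar> \<le> (\<bar>x\<bar> + sqrt h) ^ n" for x
    unfolding power_abs by (intro power_mono abs_jump_le h abs_ge_zero)+
  have "norm (jump_weight h x *\<^sub>R jump_up h x ^ n) \<le> norm ((\<bar>x\<bar> + sqrt h) ^ n)" for x
    unfolding real_norm_def real_scaleR_def
    by (rule order_trans[OF b[OF jump_weight_bounds[OF h] u(1)] abs_ge_self])
  then show "integrable \<nu> (\<lambda>x. jump_weight h x *\<^sub>R jump_up h x ^ n)"
    by (intro Bochner_Integration.integrable_bound[OF i]) auto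
  have "norm ((1 - jump_weight h x) *\<^sub>R jump_down h x ^ n) \<le> norm ((\<bar>x\<bar> + sqrt h) ^ n)" for x
    unfolding real_norm_def real_scaleR_def
    by (rule order_trans[OF b[OF _ _ u(2)] abs_ge_self]) (use jump_weight_bounds[OF h, of x] in auto)
  then show "integrable \<nu> (\<lambda>x. (1 - jump_weight h x) *\<^sub>R jump_down h x ^ n)"
    by (intro Bochner_Integration.integrable_bound[OF i]) auto
qed

lemma moment_law_jump: "moment_law (jump_law h \<nu>)"
  unfolding moment_law_def finite_moments_def jump_law_def
  by (intro conjI allI real_distribution_two_point_mixture integrable_two_point_mixture
      jump_weight_bounds[OF h] jump_law_integrable_aux real_distribution_axioms measurable_jump)
    measurable

lemma moments_jump_law:
  "(\<integral>x. x ^ n \<partial>jump_law h \<nu>) =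
     (\<integral>x. jump_weight h x * jump_up h x ^ n + (1 - jump_weight h x) * jump_down h x ^ n \<partial>\<nu>)"
  unfolding jump_law_def
  by (subst integral_two_point_mixture)
    (use jump_weight_bounds[OF h] jump_law_integrable_aux real_distribution_axioms in auto)

lemma mgf_jump_law:
  "fps_nth (mgf_fps (jump_law h \<nu>)) 0 = 1"
  "fps_nth (mgf_fps (jump_law h \<nu>)) (Suc 0) = 0"
  "fps_nth (mgf_fps (jump_law h \<nu>)) (Suc (Suc k)) = h * (\<integral>x. jump_moment h x k \<partial>\<nu>) / fact (Suc (Suc k))"
proof -
  show "fps_nth (mgf_fps (jump_law h \<nu>)) 0 = 1"
    by (rule mgf_nth_0) (rule moment_lawD(3)[OF moment_law_jump])
  show "fps_nth (mgf_fps (jump_law h \<nu>)) (Suc 0) = 0"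
    unfolding fps_nth_mgf moments_jump_law by (simp add: jump_mean[OF h])
  show "fps_nth (mgf_fps (jump_law h \<nu>)) (Suc (Suc k)) = h * (\<integral>x. jump_moment h x k \<partial>\<nu>) / fact (Suc (Suc k))"
    using jump_moment_eq[OF h, of _ k] unfolding fps_nth_mgf moments_jump_law
    by (simp del: power_Suc fact_Suc)
qed

lemma char_jump_law:
  "char (jump_law h \<nu>) t - 1 = h * (\<integral>x. (1 - complex_of_real (jump_weight h x)) * levy_char t (jump_up h x) +
       jump_weight h x * levy_char t (jump_down h x) \<partial>\<nu>)"
proof -
  have wb: "\<bar>jump_weight h x\<bar> \<le> 1" "\<bar>1 - jump_weight h x\<bar> \<le> 1" for x
    using jump_weight_bounds[OF h, of x] by auto
  have i: "integrable \<nu> (\<lambda>x. jump_weight h x *\<^sub>R iexp (t * jump_up h x))"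
    "integrable \<nu> (\<lambda>x. (1 - jump_weight h x) *\<^sub>R iexp (t * jump_down h x))"
    by (intro integrable_const_bound[of _ 1]; use wb in simp)+
  have "char (jump_law h \<nu>) t = (\<integral>x. jump_weight h x *\<^sub>R iexp (t * jump_up h x) +
      (1 - jump_weight h x) *\<^sub>R iexp (t * jump_down h x) \<partial>\<nu>)"
    unfolding char_def jump_law_def
    by (rule integral_two_point_mixture[OF real_distribution_axioms measurable_jump(3,1,2)
          jump_weight_bounds[OF h] _ i]) measurable
  then have "char (jump_law h \<nu>) t - 1 = (\<integral>x. jump_weight h x *\<^sub>R iexp (t * jump_up h x) +
      (1 - jump_weight h x) *\<^sub>R iexp (t * jump_down h x) - 1 \<partial>\<nu>)"
    using i by (subst Bochner_Integration.integral_diff) (auto simp: prob_space simp del: space_eq_univ)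
  also have "\<dots> = (\<integral>x. h * ((1 - complex_of_real (jump_weight h x)) * levy_char t (jump_up h x) +
       jump_weight h x * levy_char t (jump_down h x)) \<partial>\<nu>)"
    unfolding jump_char[OF h, symmetric] by (simp only: scaleR_conv_of_real of_real_diff of_real_1)
  finally show ?thesis by simp
qed

end

lemma norm_convex_levy_le:
  assumes "0 < h"
  shows "norm ((1 - complex_of_real (jump_weight h x)) * levy_char t u + jump_weight h x * levy_char t v) \<le> t\<^sup>2 / 2"
proof -
  have "norm ((1 - complex_of_real (jump_weight h x)) * levy_char t u + jump_weight h x * levy_char t v)
      \<le> norm (complex_of_real (1 - jump_weight h x) * levy_char t u) + norm (jump_weight h x * levy_char t v)"
    by (simp add: norm_triangle_ineq)
  also have "\<dots> = (1 - jump_weight h x) * norm (levy_char t u) + jump_weight h x * norm (levy_char t v)"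
    using jump_weight_bounds[OF assms, of x] by (simp only: norm_mult norm_of_real)
  also have "\<dots> \<le> (1 - jump_weight h x) * (t\<^sup>2 / 2) + jump_weight h x * (t\<^sup>2 / 2)"
    using jump_weight_bounds[OF assms, of x] by (intro add_mono mult_left_mono norm_levy_char_le) auto
  also have "\<dots> = t\<^sup>2 / 2" by (simp only: distrib_right[symmetric]) simp
  finally show ?thesis .
qed

text \<open>In cumulant terms: \<open>c\<close> times this series, taken as an exponent, has as
  cumulants \<open>c\<close> times the moments of \<open>\<nu>\<close>, shifted by two
  places.\<close>

lemma fps_nth_integral_levy:
  "fps_nth (integral_fps \<nu> levy_integrand) n =
     (if 2 \<le> n then (\<integral>x. x ^ (n - 2) \<partial>\<nu>) / fact n else 0)"
proof -
  have "fps_nth (levy_integrand x) n = (if 2 \<le> n then x ^ (n - 2) / fact n else 0)" for x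
  proof (cases "2 \<le> n")
    case True
    then have "x ^ n = x ^ (n - 2) * x\<^sup>2" by (metis power_add le_add_diff_inverse2)
    then show ?thesis using True
      by (cases "n = 2") (auto simp: levy_integrand_def fps_X_power_nth fact_numeral)
  next
    case False
    then have "n = 0 \<or> n = 1" by auto
    then show ?thesis by (auto simp: levy_integrand_def fps_X_power_nth)
  qed
  then show ?thesis by (simp add: integral_fps_def)
qed

text \<open>\<open>N n\<close> is the law of a sum of \<open>n + 1\<close> independent centred
  two-point jumps of variance \<open>c / (n + 1)\<close>, with the parameter \<open>x\<close> of
  each jump drawn from \<open>\<nu>\<close>. The same array yields the limits of the moments and of
  the characteristic functions, which ties the formal exponent to the analytic one.\<close>

lemma kolmogorov_approximation:
  assumes \<nu>: "moment_law \<nu>" and c: "0 < c"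
  obtains N where "\<And>n. moment_law (N n)"
    "\<And>k. (\<lambda>n. fps_nth (mgf_fps (N n)) k) \<longlonglongrightarrow>
       fps_nth (fps_exp 1 oo (fps_const c * integral_fps \<nu> levy_integrand)) k"
    "\<And>t. (\<lambda>n. char (N n) t) \<longlonglongrightarrow> exp (c * (\<integral>x. levy_char t x \<partial>\<nu>))"
proof -
  interpret real_distribution \<nu> using \<nu> by (rule moment_lawD)
  define h where "h n = c / real (Suc n)" for n
  have h: "0 < h n" for n using c by (simp add: h_def)
  have nh: "real (Suc n) * h n = c" for n by (simp add: h_def del: of_nat_Suc)
  have h0: "h \<longlonglongrightarrow> 0"
    using tendsto_mult_left[OF LIMSEQ_inverse_real_of_nat, of c] by (simp add: h_def[abs_def] divide_inverse)
  define N where "N n = (((\<star>) (jump_law (h n) \<nu>) ^^ Suc n) (return borel 0))" for n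
  show ?thesis
  proof (rule that)
    show "moment_law (N n)" for n
      unfolding N_def by (intro moment_law_convolution_power moment_law_jump h \<nu>)
    show "(\<lambda>n. fps_nth (mgf_fps (N n)) k) \<longlonglongrightarrow>
       fps_nth (fps_exp 1 oo (fps_const c * integral_fps \<nu> levy_integrand)) k" for k
      unfolding N_def mgf_convolution_power[OF moment_law_jump[OF h \<nu>]]
    proof (rule fps_power_limit)
      show "(\<lambda>n. real (Suc n) * fps_nth (mgf_fps (jump_law (h n) \<nu>)) (Suc k)) \<longlonglongrightarrow>
          fps_nth (fps_const c * integral_fps \<nu> levy_integrand) (Suc k)" for k
      proof (cases k)
        case (Suc j)
        have "real (Suc n) * fps_nth (mgf_fps (jump_law (h n) \<nu>)) (Suc k) =
            c * (\<integral>x. x ^ 0 * jump_moment (h n) x j \<partial>\<nu>) / fact (Suc k)" for n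
          unfolding Suc mgf_jump_law(3)[OF h \<nu>] using nh[of n] by simp
        moreover have "(\<lambda>n. c * (\<integral>x. x ^ 0 * jump_moment (h n) x j \<partial>\<nu>) / fact (Suc k))
            \<longlonglongrightarrow> c * (\<integral>x. x ^ (0 + j) \<partial>\<nu>) / fact (Suc k)"
          by (intro tendsto_intros jump_moment_limit \<nu> h0) auto
        ultimately show ?thesis
          using Suc by (simp add: fps_nth_integral_levy del: of_nat_Suc)
      qed (simp add: mgf_jump_law(2)[OF h \<nu>] fps_nth_integral_levy)
    qed (simp_all add: mgf_jump_law(1)[OF h \<nu>] fps_nth_integral_levy)
    show "(\<lambda>n. char (N n) t) \<longlonglongrightarrow> exp (c * (\<integral>x. levy_char t x \<partial>\<nu>))" for t
      unfolding N_def char_convolution_power[OF moment_law_jump[OF h \<nu>]]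
    proof (rule complex_power_limit)
      show "norm (char (jump_law (h n) \<nu>) t) \<le> 1" for n
        by (intro real_distribution.cmod_char_le_1 moment_lawD moment_law_jump h \<nu>)
      have eq: "of_nat (Suc n) * (char (jump_law (h n) \<nu>) t - 1) =
          c * (\<integral>x. (1 - complex_of_real (jump_weight (h n) x)) * levy_char t (jump_up (h n) x) +
             jump_weight (h n) x * levy_char t (jump_down (h n) x) \<partial>\<nu>)" for n
      proof -
        have "of_nat (Suc n) * complex_of_real (h n) = complex_of_real c"
          unfolding nh[of n, symmetric] by (simp del: of_nat_Suc)
        then show ?thesis
          unfolding char_jump_law[OF h \<nu>] mult.assoc[symmetric] by (simp only:)
      qed
      show "(\<lambda>n. of_nat (Suc n) * (char (jump_law (h n) \<nu>) t - 1)) \<longlonglongrightarrow> c * (\<integral>x. levy_char t x \<partial>\<nu>)"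
        unfolding eq
      proof (intro tendsto_mult_left integral_dominated_convergence[where w = "\<lambda>_. t\<^sup>2 / 2"])
        show "AE x in \<nu>. (\<lambda>n. (1 - complex_of_real (jump_weight (h n) x)) * levy_char t (jump_up (h n) x) +
             jump_weight (h n) x * levy_char t (jump_down (h n) x)) \<longlonglongrightarrow> levy_char t x"
          by (intro AE_I2 jump_levy_limit h h0)
        show "AE x in \<nu>. norm ((1 - complex_of_real (jump_weight (h n) x)) * levy_char t (jump_up (h n) x) +
             jump_weight (h n) x * levy_char t (jump_down (h n) x)) \<le> t\<^sup>2 / 2" for n
          by (intro AE_I2 norm_convex_levy_le h)
      qed auto
    qed
  qed
qed

section \<open>The characteristic function and the Kolmogorov measure\<close>

text \<open>Any weak limit of the array has the moments of \<open>\<mu>\<close> and is therefore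
  \<open>\<mu>\<close>. The characteristic functions converge along the full sequence to the
  exponential, so the limit along the subsequence must agree with it.\<close>

lemma char_eq_exp_levy:
  assumes \<mu>: "identifiable_by_moments \<mu>" and \<nu>: "moment_law \<nu>" and c: "0 < c"
    and mgf: "mgf_fps \<mu> = fps_exp 1 oo (fps_const c * integral_fps \<nu> levy_integrand)"
  shows "char \<mu> t = exp (c * (\<integral>x. levy_char t x \<partial>\<nu>))"
proof -
  obtain N where N: "\<And>n. moment_law (N n)"
    "\<And>k. (\<lambda>n. fps_nth (mgf_fps (N n)) k) \<longlonglongrightarrow> fps_nth (mgf_fps \<mu>) k"
    "\<And>t. (\<lambda>n. char (N n) t) \<longlonglongrightarrow> exp (c * (\<integral>x. levy_char t x \<partial>\<nu>))"
    using kolmogorov_approximation[OF \<nu> c] unfolding mgf by metis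
  have "(\<lambda>n. \<integral>x. x ^ k \<partial>N n) \<longlonglongrightarrow> (\<integral>x. x ^ k \<partial>\<mu>)" for k
    unfolding moment_mgf by (intro tendsto_mult_left N)
  from method_of_moments[OF N(1) this]
  obtain r \<mu>' where r: "strict_mono r" and \<mu>': "moment_law \<mu>'" "weak_conv_m (N \<circ> r) \<mu>'"
    "\<And>k. (\<integral>x. x ^ k \<partial>\<mu>') = (\<integral>x. x ^ k \<partial>\<mu>)" by blast
  have "\<mu>' = \<mu>"
    using \<mu> \<mu>' by (intro identifiable_mgf_eqI) (auto simp: fps_eq_iff fps_nth_mgf)
  with \<mu>' have "(\<lambda>n. char (N (r n)) t) \<longlonglongrightarrow> char \<mu> t"
    using levy_continuity1[of "N \<circ> r" \<mu> t] N(1) by (auto simp: comp_def moment_lawD)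
  moreover have "(\<lambda>n. char (N (r n)) t) \<longlonglongrightarrow> exp (c * (\<integral>x. levy_char t x \<partial>\<nu>))"
    using LIMSEQ_subseq_LIMSEQ[OF N(3) r] by (simp add: comp_def)
  ultimately show ?thesis by (rule LIMSEQ_unique)
qed

lemma levy_char_0: "levy_char 0 x = 0"
  by (simp add: levy_char_def)

text \<open>The affine part \<open>1 + i t x\<close> is invisible to second differences in
  \<open>t\<close>; what remains is \<open>e^(itx)\<close> times a factor even in
  \<open>h\<close>.\<close>

lemma levy_char_second_difference:
  "levy_char (t + h) x + levy_char (t - h) x - 2 * levy_char t x =
     iexp (t * x) * (levy_char h x + levy_char (- h) x)"
proof (cases "x = 0")
  case False
  have "iexp ((t + h) * x) = iexp (t * x) * iexp (h * x)" "iexp ((t - h) * x) = iexp (t * x) * iexp (- h * x)"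
    by (simp_all add: exp_add[symmetric] algebra_simps)
  then have "(levy_char (t + h) x + levy_char (t - h) x - 2 * levy_char t x) * (complex_of_real x)\<^sup>2 =
     iexp (t * x) * (levy_char h x + levy_char (- h) x) * (complex_of_real x)\<^sup>2"
    unfolding distrib_left distrib_right left_diff_distrib mult.assoc levy_char_mult
    by (simp add: algebra_simps)
  then show ?thesis using False by simp
qed (simp add: levy_char_def field_simps power2_eq_square)

context real_distribution
begin

lemma integrable_levy_char: "integrable M (levy_char t)"
  by (rule integrable_const_bound[of _ "t\<^sup>2 / 2"]) (rule AE_I2, rule norm_levy_char_le, measurable)

lemma isCont_integral_levy_char: "isCont (\<lambda>t. \<integral>x. levy_char t x \<partial>M) t"
  unfolding continuous_at_sequentially comp_def
proof safe
  fix s :: "nat \<Rightarrow> real" assume s: "s \<longlonglongrightarrow> t"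
  then obtain B where B: "\<And>n. \<bar>s n\<bar> \<le> B"
    using convergent_imp_Bseq[of s] by (auto simp: convergent_def Bseq_def)
  show "(\<lambda>n. \<integral>x. levy_char (s n) x \<partial>M) \<longlonglongrightarrow> (\<integral>x. levy_char t x \<partial>M)"
  proof (rule integral_dominated_convergence[where w = "\<lambda>_. B\<^sup>2 / 2"])
    show "AE x in M. norm (levy_char (s n) x) \<le> B\<^sup>2 / 2" for n
    proof (rule AE_I2)
      fix x
      have "(s n)\<^sup>2 \<le> B\<^sup>2" using power_mono[OF B[of n], of 2] by simp
      then show "norm (levy_char (s n) x) \<le> B\<^sup>2 / 2"
        using norm_levy_char_le[of "s n" x] by linarith
    qed
    show "AE x in M. (\<lambda>n. levy_char (s n) x) \<longlonglongrightarrow> levy_char t x"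
    proof (rule AE_I2)
      fix x show "(\<lambda>n. levy_char (s n) x) \<longlonglongrightarrow> levy_char t x"
        by (cases "x = 0") (auto simp: levy_char_def intro!: tendsto_intros s)
    qed
  qed auto
qed

text \<open>The integral of the kernel has second derivative \<open>- char M t\<close> in
  \<open>t\<close>; the sequence is its negated second difference quotient with step
  \<open>1 / (n + 1)\<close>.\<close>

lemma char_limit_levy:
  "(\<lambda>n. - (of_nat (Suc n))\<^sup>2 * ((\<integral>x. levy_char (t + 1 / Suc n) x \<partial>M) + (\<integral>x. levy_char (t - 1 / Suc n) x \<partial>M)
       - 2 * (\<integral>x. levy_char t x \<partial>M))) \<longlonglongrightarrow> char M t"
proof -
  define h where "h n = 1 / real (Suc n)" for n
  have h: "0 < h n" for n by (simp add: h_def)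
  have hl: "h \<longlonglongrightarrow> 0"
    using LIMSEQ_inverse_real_of_nat by (simp add: h_def[abs_def] inverse_eq_divide)
  have eq: "- (of_nat (Suc n))\<^sup>2 * ((\<integral>x. levy_char (t + h n) x \<partial>M) + (\<integral>x. levy_char (t - h n) x \<partial>M)
       - 2 * (\<integral>x. levy_char t x \<partial>M)) =
     (\<integral>x. iexp (t * x) * (- (levy_char (h n) x + levy_char (- h n) x) / (complex_of_real (h n))\<^sup>2) \<partial>M)" for n
  proof -
    have "(\<integral>x. levy_char (t + h n) x \<partial>M) + (\<integral>x. levy_char (t - h n) x \<partial>M) - 2 * (\<integral>x. levy_char t x \<partial>M) =
       (\<integral>x. levy_char (t + h n) x + levy_char (t - h n) x - 2 * levy_char t x \<partial>M)"
      by (simp add: integrable_levy_char)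
    also have "\<dots> = (\<integral>x. iexp (t * x) * (levy_char (h n) x + levy_char (- h n) x) \<partial>M)"
      unfolding levy_char_second_difference ..
    finally have *: "(\<integral>x. levy_char (t + h n) x \<partial>M) + (\<integral>x. levy_char (t - h n) x \<partial>M) - 2 * (\<integral>x. levy_char t x \<partial>M) =
       (\<integral>x. iexp (t * x) * (levy_char (h n) x + levy_char (- h n) x) \<partial>M)" .
    have "iexp (t * x) * (- (levy_char (h n) x + levy_char (- h n) x) / (complex_of_real (h n))\<^sup>2) =
        - (of_nat (Suc n))\<^sup>2 * (iexp (t * x) * (levy_char (h n) x + levy_char (- h n) x))" for x
      by (simp add: h_def power_divide algebra_simps del: of_nat_Suc)
    then show ?thesis unfolding * by simp
  qed
  have bound: "norm (- (levy_char (h n) x + levy_char (- h n) x) / (complex_of_real (h n))\<^sup>2 - 1) \<le> \<bar>x\<bar> / 3 * h n" for n x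
  proof -
    have "norm (levy_char (h n) x + levy_char (- h n) x + (complex_of_real (h n))\<^sup>2) =
        norm ((levy_char (h n) x + (complex_of_real (h n))\<^sup>2 / 2) + (levy_char (- h n) x + (complex_of_real (- h n))\<^sup>2 / 2))"
      by (simp add: algebra_simps)
    also have "\<dots> \<le> \<bar>h n\<bar> ^ 3 / 6 * \<bar>x\<bar> + \<bar>- h n\<bar> ^ 3 / 6 * \<bar>x\<bar>"
      by (intro norm_triangle_le add_mono levy_char_near_0)
    also have "\<dots> = (\<bar>x\<bar> / 3 * h n) * (h n)\<^sup>2"
      using h[of n] by (simp add: power2_eq_square power3_eq_cube)
    finally have "norm (levy_char (h n) x + levy_char (- h n) x + (complex_of_real (h n))\<^sup>2) / (h n)\<^sup>2 \<le> \<bar>x\<bar> / 3 * h n"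
      using h[of n] by (subst pos_divide_le_eq) auto
    also have "norm (levy_char (h n) x + levy_char (- h n) x + (complex_of_real (h n))\<^sup>2) / (h n)\<^sup>2 =
        norm ((levy_char (h n) x + levy_char (- h n) x + (complex_of_real (h n))\<^sup>2) / (complex_of_real (h n))\<^sup>2)"
      by (simp add: norm_divide norm_power)
    also have "\<dots> = norm (- (levy_char (h n) x + levy_char (- h n) x) / (complex_of_real (h n))\<^sup>2 - 1)"
    proof -
      have "- (levy_char (h n) x + levy_char (- h n) x) / (complex_of_real (h n))\<^sup>2 - 1 =
        - ((levy_char (h n) x + levy_char (- h n) x + (complex_of_real (h n))\<^sup>2) / (complex_of_real (h n))\<^sup>2)"
        using h[of n] by (simp add: add_divide_distrib diff_divide_distrib)
      then show ?thesis by (simp only: norm_minus_cancel)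
    qed
    finally show ?thesis .
  qed
  have "(\<lambda>n. \<integral>x. iexp (t * x) * (- (levy_char (h n) x + levy_char (- h n) x) / (complex_of_real (h n))\<^sup>2) \<partial>M)
      \<longlonglongrightarrow> (\<integral>x. iexp (t * x) * 1 \<partial>M)"
  proof (rule integral_dominated_convergence[where w = "\<lambda>_. 1"])
    show "AE x in M. (\<lambda>n. iexp (t * x) * (- (levy_char (h n) x + levy_char (- h n) x) / (complex_of_real (h n))\<^sup>2))
        \<longlonglongrightarrow> iexp (t * x) * 1"
    proof (intro AE_I2 tendsto_mult_left)
      fix x
      have "(\<lambda>n. \<bar>x\<bar> / 3 * h n) \<longlonglongrightarrow> \<bar>x\<bar> / 3 * 0" by (intro tendsto_intros hl)
      then have "(\<lambda>n. - (levy_char (h n) x + levy_char (- h n) x) / (complex_of_real (h n))\<^sup>2 - 1) \<longlonglongrightarrow> 0"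
        by (intro Lim_null_comparison[OF always_eventually[OF allI[OF bound]]]) simp
      then show "(\<lambda>n. - (levy_char (h n) x + levy_char (- h n) x) / (complex_of_real (h n))\<^sup>2) \<longlonglongrightarrow> 1"
        by (simp only: LIM_zero_iff)
    qed
    \<comment> \<open>Each of the two kernels is at most \<open>h^2 / 2\<close>, which the division
      by \<open>h^2\<close> turns into the dominating constant 1.\<close>
    show "AE x in M. norm (iexp (t * x) * (- (levy_char (h n) x + levy_char (- h n) x) / (complex_of_real (h n))\<^sup>2)) \<le> 1" for n
    proof (rule AE_I2)
      fix x
      have "norm (levy_char (h n) x + levy_char (- h n) x) \<le> (h n)\<^sup>2 / 2 + (- h n)\<^sup>2 / 2"
        by (intro norm_triangle_le add_mono norm_levy_char_le)
      then have "norm (- (levy_char (h n) x + levy_char (- h n) x)) \<le> (h n)\<^sup>2"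
        unfolding norm_minus_cancel by simp
      then show "norm (iexp (t * x) * (- (levy_char (h n) x + levy_char (- h n) x) / (complex_of_real (h n))\<^sup>2)) \<le> 1"
        using h[of n] by (simp add: norm_mult norm_divide norm_power divide_le_eq_1)
    qed
  qed auto
  then show ?thesis
    unfolding eq[symmetric] by (simp add: char_def h_def[abs_def] del: of_nat_Suc)
qed

end

text \<open>Equal exponentials fix the exponents only up to multiples of \<open>2 pi i\<close>. The
  difference of the exponents is continuous in \<open>t\<close>, has a discrete range and vanishes
  at \<open>t = 0\<close>, so it is 0 throughout, and second differences recover both characteristic
  functions.\<close>

lemma levy_char_integral_inject:
  assumes \<nu>: "real_distribution \<nu>" and \<nu>': "real_distribution \<nu>'" and c: "c \<noteq> (0::real)"
    and eq: "\<And>t. exp (c * (\<integral>x. levy_char t x \<partial>\<nu>)) = exp (c * (\<integral>x. levy_char t x \<partial>\<nu>'))"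
  shows "\<nu> = \<nu>'"
proof -
  interpret \<nu>: real_distribution \<nu> by fact
  interpret \<nu>': real_distribution \<nu>' by fact
  define f where "f t = c * (\<integral>x. levy_char t x \<partial>\<nu>) - c * (\<integral>x. levy_char t x \<partial>\<nu>')" for t
  have f2: "\<exists>n::int. f t = of_int n * (2 * pi * \<i>)" for t
    using eq[of t] unfolding exp_eq by (auto simp: f_def algebra_simps)
  have "f constant_on UNIV"
  proof (rule continuous_discrete_range_constant)
    show "continuous_on UNIV f" unfolding f_def
      by (intro continuous_at_imp_continuous_on ballI continuous_intros
          \<nu>.isCont_integral_levy_char \<nu>'.isCont_integral_levy_char)
    show "\<exists>e>0. \<forall>y. y \<in> UNIV \<and> f y \<noteq> f x \<longrightarrow> e \<le> norm (f y - f x)" for x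
    proof (intro exI[of _ 1] conjI allI impI)
      fix y assume y: "y \<in> UNIV \<and> f y \<noteq> f x"
      obtain m n :: int where mn: "f y = of_int m * (2 * pi * \<i>)" "f x = of_int n * (2 * pi * \<i>)"
        using f2 by metis
      have "norm (f y - f x) = \<bar>real_of_int (m - n)\<bar> * (2 * pi)"
        unfolding mn left_diff_distrib[symmetric] of_int_diff[symmetric]
        by (simp only: norm_mult norm_of_int norm_of_real norm_numeral norm_ii) simp
      moreover have "1 \<le> \<bar>real_of_int (m - n)\<bar>"
      proof -
        have "m \<noteq> n" using y mn by auto
        then have "1 \<le> \<bar>m - n\<bar>" by linarith
        then show ?thesis by (metis of_int_abs of_int_1_le_iff)
      qed
      moreover have "1 \<le> 2 * pi" using pi_gt3 by simp
      ultimately show "1 \<le> norm (f y - f x)"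
        using mult_mono[of 1 "\<bar>real_of_int (m - n)\<bar>" 1 "2 * pi"] by simp
    qed simp
  qed auto
  moreover have "f 0 = 0" by (simp add: f_def levy_char_0)
  ultimately have "f t = 0" for t by (metis UNIV_I constant_on_def)
  then have G: "(\<integral>x. levy_char t x \<partial>\<nu>) = (\<integral>x. levy_char t x \<partial>\<nu>')" for t
    using c by (auto simp: f_def)
  have "char \<nu> t = char \<nu>' t" for t
    using \<nu>.char_limit_levy[of t] \<nu>'.char_limit_levy[of t] unfolding G by (rule LIMSEQ_unique)
  then show ?thesis by (intro Levy_uniqueness \<nu> \<nu>') auto
qed

lemma identifiable_levy_measure:
  assumes \<mu>: "identifiable_by_moments \<mu>" and \<nu>: "moment_law \<nu>" and c: "0 < c"
    and mgf: "mgf_fps \<mu> = fps_exp 1 oo (fps_const c * integral_fps \<nu> levy_integrand)"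
  shows "identifiable_by_moments \<nu>"
  unfolding identifiable_by_moments_def
proof (intro conjI allI impI)
  fix \<nu>' assume \<nu>': "real_distribution \<nu>'" "finite_moments \<nu>'"
    and eq: "\<forall>n::nat. (\<integral>x. x ^ n \<partial>\<nu>') = (\<integral>x. x ^ n \<partial>\<nu>)"
  have "integral_fps \<nu>' levy_integrand = integral_fps \<nu> levy_integrand"
    using eq by (simp add: fps_eq_iff fps_nth_integral_levy)
  then have mgf': "mgf_fps \<mu> = fps_exp 1 oo (fps_const c * integral_fps \<nu>' levy_integrand)"
    using mgf by simp
  have "moment_law \<nu>'" using \<nu>' by (simp add: moment_law_def)
  then show "\<nu>' = \<nu>"
    using c char_eq_exp_levy[OF \<mu> _ c mgf'] char_eq_exp_levy[OF \<mu> \<nu> c mgf]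
    by (intro levy_char_integral_inject[where c = c] \<nu>' moment_lawD[OF \<nu>]) auto
qed (rule moment_lawD[OF \<nu>])

section \<open>Selfdecomposable laws\<close>

lemma fps_mult_ode_cancel:
  fixes f g p L N :: "real fps"
  assumes "fps_deriv f = L * f" "fps_deriv g = N * g" "f = g * p" "g \<noteq> 0"
  shows "fps_deriv p = (L - N) * p"
proof -
  have "L * (g * p) = N * g * p + g * fps_deriv p"
    using assms(1) unfolding assms(3) fps_deriv_mult assms(2) by (simp add: algebra_simps)
  then have "g * fps_deriv p = g * ((L - N) * p)" by (simp add: algebra_simps)
  then show ?thesis using assms(4) by simp
qed

lemma fps_nth_scaled_log_deriv:
  "fps_nth (fps_const a * (L oo (fps_const a * fps_X))) i = (a::real) ^ Suc i * fps_nth L i"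
  by (simp add: fps_nth_scale)

text \<open>For log-derivatives the factorization reads \<open>L(y) = a L(a y) + P(y)\<close>. The
  coefficient of \<open>L\<close> with index \<open>i\<close> belongs to the cumulant of order
  \<open>i + 1\<close>, hence the exponent \<open>Suc i\<close>.\<close>

lemma selfdecomposition_ode:
  fixes f p L :: "real fps"
  assumes f: "fps_deriv f = L * f" "fps_nth f 0 = 1"
    and p: "f = (f oo (fps_const a * fps_X)) * p"
  shows "fps_deriv p = Abs_fps (\<lambda>i. (1 - a ^ Suc i) * fps_nth L i) * p"
proof -
  have "f oo (fps_const a * fps_X) \<noteq> 0"
    using f(2) fps_nth_scale[of f a 0] by (metis fps_zero_nth mult.left_neutral power_0 zero_neq_one)
  then have "fps_deriv p = (L - fps_const a * (L oo (fps_const a * fps_X))) * p"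
    using fps_mult_ode_cancel[OF f(1) fps_scale_ode[OF f(1)] p] by simp
  also have "L - fps_const a * (L oo (fps_const a * fps_X)) = Abs_fps (\<lambda>i. (1 - a ^ Suc i) * fps_nth L i)"
    by (rule fps_ext) (simp only: fps_sub_nth fps_nth_scaled_log_deriv fps_nth_Abs_fps, simp add: algebra_simps)
  finally show ?thesis .
qed

text \<open>A truncated autoregressive series: the law of the sum of \<open>b^j Y_j\<close> over
  \<open>j < k\<close> for independent copies \<open>Y_j\<close>.\<close>

fun scaled_convolution :: "real \<Rightarrow> real measure \<Rightarrow> nat \<Rightarrow> real measure" where
  "scaled_convolution b Y 0 = return borel 0"
| "scaled_convolution b Y (Suc k) = (distr Y borel ((*) (b ^ k)) \<star> scaled_convolution b Y k)"

lemma
  assumes Y: "moment_law Y" and ode: "fps_deriv (mgf_fps Y) = N * mgf_fps Y"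
  shows moment_law_scaled_convolution: "moment_law (scaled_convolution b Y k)"
    and scaled_convolution_ode: "fps_deriv (mgf_fps (scaled_convolution b Y k)) =
      Abs_fps (\<lambda>i. (\<Sum>j<k. (b ^ Suc i) ^ j) * fps_nth N i) * mgf_fps (scaled_convolution b Y k)"
proof -
  show *: "moment_law (scaled_convolution b Y k)" for k
    by (induction k) (auto intro: moment_law_return moment_law_convolution moment_law_scale Y)
  show "fps_deriv (mgf_fps (scaled_convolution b Y k)) =
      Abs_fps (\<lambda>i. (\<Sum>j<k. (b ^ Suc i) ^ j) * fps_nth N i) * mgf_fps (scaled_convolution b Y k)"
  proof (induction k)
    case (Suc k)
    have mgf: "mgf_fps (scaled_convolution b Y (Suc k)) =
        (mgf_fps Y oo (fps_const (b ^ k) * fps_X)) * mgf_fps (scaled_convolution b Y k)"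
      by (simp only: scaled_convolution.simps mgf_convolution[OF moment_law_scale[OF Y] *] mgf_scale[OF Y])
    have eq: "fps_const (b ^ k) * (N oo (fps_const (b ^ k) * fps_X)) +
        Abs_fps (\<lambda>i. (\<Sum>j<k. (b ^ Suc i) ^ j) * fps_nth N i) =
        Abs_fps (\<lambda>i. (\<Sum>j<Suc k. (b ^ Suc i) ^ j) * fps_nth N i)"
    proof (rule fps_ext)
      fix i
      have "(b ^ k) ^ Suc i = (b ^ Suc i) ^ k" by (simp only: power_mult[symmetric] mult.commute)
      then show "fps_nth (fps_const (b ^ k) * (N oo (fps_const (b ^ k) * fps_X)) +
        Abs_fps (\<lambda>i. (\<Sum>j<k. (b ^ Suc i) ^ j) * fps_nth N i)) i =
        fps_nth (Abs_fps (\<lambda>i. (\<Sum>j<Suc k. (b ^ Suc i) ^ j) * fps_nth N i)) i"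
        unfolding fps_add_nth fps_nth_scaled_log_deriv fps_nth_Abs_fps sum.lessThan_Suc
        by (simp only: algebra_simps)
    qed
    show ?case unfolding mgf using fps_mult_ode[OF fps_scale_ode[OF ode, of "b ^ k"] Suc] unfolding eq .
  qed (simp add: mgf_return_0 fps_eq_iff fps_mult_nth)
qed

text \<open>Here \<open>a\<close> is the order of a cumulant, \<open>n\<close> the order of the root
  and \<open>1 / (m + 1)\<close> the lag. The two factors with shrinking exponents have ratio
  tending to \<open>1 / n\<close>, and the numerator of the geometric sum tends to 1.\<close>

lemma geometric_scale_limit:
  fixes a n :: real
  assumes "0 < a" "0 < n"
  shows "(\<lambda>m. (1 - exp (- (a / real (Suc m)))) *
      ((1 - exp (- (a * n * real (Suc m)))) / (1 - exp (- (a * n / real (Suc m)))))) \<longlonglongrightarrow> 1 / n"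
  using assms by real_asymp (simp add: field_simps)

text \<open>With \<open>X = \<Sum>\<^sub>k e\<^bsup>-k\<tau>\<^esup> Y\<^sub>k\<close> for independent copies of the innovation \<open>Y\<close> at lag \<open>\<tau>\<close>,
  keeping every \<open>n\<close>-th summand and letting \<open>\<tau> \<rightarrow> 0\<close> leaves an \<open>n\<close>-th convolution root.\<close>

lemma selfdecomposable_root:
  assumes \<mu>: "prob_space \<mu>" and ode: "fps_deriv (mgf_fps \<mu>) = L * mgf_fps \<mu>"
    and sd: "\<And>\<tau>. 0 < \<tau> \<Longrightarrow> \<exists>Y. moment_law Y \<and>
      mgf_fps \<mu> = (mgf_fps \<mu> oo (fps_const (exp (- \<tau>)) * fps_X)) * mgf_fps Y"
    and n: "0 < n"
  obtains \<nu> where "moment_law \<nu>" "fps_deriv (mgf_fps \<nu>) = (fps_const (1 / real n) * L) * mgf_fps \<nu>"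
proof -
  define \<tau> where "\<tau> m = 1 / real (Suc m)" for m
  define b where "b m = exp (- (real n * \<tau> m))" for m
  have \<tau>: "0 < \<tau> m" for m by (simp add: \<tau>_def)
  from sd[OF \<tau>] obtain Y where Y: "\<And>m. moment_law (Y m)"
    "\<And>m. mgf_fps \<mu> = (mgf_fps \<mu> oo (fps_const (exp (- \<tau> m)) * fps_X)) * mgf_fps (Y m)" by metis
  \<comment> \<open>\<open>(m + 1)^2\<close> summands at spacing \<open>n / (m + 1)\<close> reach
    back over time \<open>n (m + 1)\<close>, so the truncated tail vanishes although the lag
    shrinks.\<close>
  define R where "R m = scaled_convolution (b m) (Y m) ((Suc m)\<^sup>2)" for m
  have Yode: "fps_deriv (mgf_fps (Y m)) = Abs_fps (\<lambda>i. (1 - exp (- \<tau> m) ^ Suc i) * fps_nth L i) * mgf_fps (Y m)" for m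
    by (rule selfdecomposition_ode[OF ode mgf_nth_0[OF \<mu>] Y(2)])
  have R: "moment_law (R m)" for m unfolding R_def by (rule moment_law_scaled_convolution[OF Y(1) Yode])
  \<comment> \<open>\<open>K\<close> is the formal logarithm of the wanted root, so that
    \<open>g\<close> is the formal \<open>n\<close>-th root of the series of
    \<open>\<mu>\<close>.\<close>
  define K where "K = fps_integral0 (fps_const (1 / real n) * L)"
  define g where "g = fps_exp 1 oo K"
  have K: "fps_nth K 0 = 0" "fps_deriv K = fps_const (1 / real n) * L"
    by (simp_all add: K_def fps_deriv_fps_integral)
  have gode: "fps_deriv g = (fps_const (1 / real n) * L) * g"
    unfolding g_def using fps_deriv_exp_compose[OF K(1)] by (simp add: K(2))
  have lim: "(\<lambda>m. fps_nth (mgf_fps (R m)) k) \<longlonglongrightarrow> fps_nth g k" for k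
  proof (rule fps_linear_ode_limit[OF _ gode])
    show "fps_deriv (mgf_fps (R m)) = Abs_fps (\<lambda>i. (\<Sum>j<(Suc m)\<^sup>2. (b m ^ Suc i) ^ j) *
        fps_nth (Abs_fps (\<lambda>i. (1 - exp (- \<tau> m) ^ Suc i) * fps_nth L i)) i) * mgf_fps (R m)" for m
      unfolding R_def by (rule scaled_convolution_ode[OF Y(1) Yode])
    show "fps_nth (mgf_fps (R m)) 0 = fps_nth g 0" for m
      using mgf_nth_0[OF moment_lawD(3)[OF R]] by (simp add: g_def)
    show "(\<lambda>m. fps_nth (Abs_fps (\<lambda>i. (\<Sum>j<(Suc m)\<^sup>2. (b m ^ Suc i) ^ j) *
        fps_nth (Abs_fps (\<lambda>i. (1 - exp (- \<tau> m) ^ Suc i) * fps_nth L i)) i)) i)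
        \<longlonglongrightarrow> fps_nth (fps_const (1 / real n) * L) i" for i
    proof -
      define a where "a = real (Suc i)"
      have a: "0 < a" by (simp add: a_def)
      have pow: "exp y ^ Suc i = exp (a * y)" for y :: real
        unfolding a_def by (rule exp_of_nat_mult[symmetric])
      have e1: "exp (- \<tau> m) ^ Suc i = exp (- (a / real (Suc m)))" for m
        unfolding pow by (simp add: \<tau>_def)
      have e2: "b m ^ Suc i = exp (- (a * real n / real (Suc m)))" for m
        unfolding b_def pow by (simp add: \<tau>_def)
      have e3: "(\<Sum>j<(Suc m)\<^sup>2. (b m ^ Suc i) ^ j) =
          (1 - exp (- (a * real n * real (Suc m)))) / (1 - exp (- (a * real n / real (Suc m))))" for m
      proof -
        have ne: "exp (- (a * real n / real (Suc m))) \<noteq> 1"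
          using a n by (simp add: field_simps)
        have "exp (- (a * real n / real (Suc m))) ^ (Suc m)\<^sup>2 =
            exp (real ((Suc m)\<^sup>2) * - (a * real n / real (Suc m)))"
          by (rule exp_of_nat_mult[symmetric])
        also have "real ((Suc m)\<^sup>2) * - (a * real n / real (Suc m)) = - (a * real n * real (Suc m))"
          by (simp only: of_nat_mult power2_eq_square) (simp del: of_nat_Suc)
        finally show ?thesis
          unfolding e2 using sum_gp_strict[of "exp (- (a * real n / real (Suc m)))" "(Suc m)\<^sup>2"] ne by simp
      qed
      have "(\<lambda>m. fps_nth L i * ((1 - exp (- (a / real (Suc m)))) *
          ((1 - exp (- (a * real n * real (Suc m)))) / (1 - exp (- (a * real n / real (Suc m)))))))
          \<longlonglongrightarrow> fps_nth L i * (1 / real n)"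
        using n a by (intro tendsto_mult_left geometric_scale_limit) auto
      then show ?thesis
        unfolding fps_nth_Abs_fps e1 e3 fps_mult_left_const_nth by (simp only: mult_ac)
    qed
  qed
  have mlim: "(\<lambda>m. \<integral>x. x ^ k \<partial>R m) \<longlonglongrightarrow> fact k * fps_nth g k" for k
    unfolding moment_mgf by (intro tendsto_mult_left lim)
  from method_of_moments[OF R mlim] obtain \<nu> where \<nu>: "moment_law \<nu>"
    "\<And>k. (\<integral>x. x ^ k \<partial>\<nu>) = fact k * fps_nth g k" by blast
  have "mgf_fps \<nu> = g" by (simp add: fps_eq_iff fps_nth_mgf \<nu>)
  then show ?thesis using that[OF \<nu>(1)] gode by simp
qed

text \<open>An \<open>n\<close>-th power multiplies the log-derivative by \<open>n\<close>, so the
  convolution power of the root has the series of \<open>\<mu>\<close>; identifiability then makes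
  the two laws equal.\<close>

lemma infinitely_divisible_if_roots:
  assumes \<mu>: "identifiable_by_moments \<mu>" "prob_space \<mu>" and ode: "fps_deriv (mgf_fps \<mu>) = L * mgf_fps \<mu>"
    and roots: "\<And>n. 0 < n \<Longrightarrow> \<exists>\<nu>. moment_law \<nu> \<and> fps_deriv (mgf_fps \<nu>) = (fps_const (1 / real n) * L) * mgf_fps \<nu>"
  shows "infinitely_divisible \<mu>"
  unfolding infinitely_divisible_def
proof (intro allI impI)
  fix n :: nat assume n: "0 < n"
  then obtain \<nu> where \<nu>: "moment_law \<nu>" and d: "fps_deriv (mgf_fps \<nu>) = (fps_const (1 / real n) * L) * mgf_fps \<nu>"
    using roots by blast
  have "mgf_fps \<nu> ^ n = mgf_fps \<mu>"
  proof (rule fps_linear_ode_unique[OF _ ode])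
    have "fps_const (real n) * (fps_const (1 / real n) * L) = L"
      using n by (simp add: mult.assoc[symmetric])
    then show "fps_deriv (mgf_fps \<nu> ^ n) = L * mgf_fps \<nu> ^ n"
      unfolding fps_power_ode[OF d] by simp
    show "fps_nth (mgf_fps \<nu> ^ n) 0 = fps_nth (mgf_fps \<mu>) 0"
      using mgf_nth_0 moment_lawD(3)[OF \<nu>] \<mu>(2) by (simp add: fps_nth_power_0_one)
  qed
  then have "((\<star>) \<nu> ^^ n) (return borel 0) = \<mu>"
    by (intro identifiable_mgf_eqI \<mu> moment_law_convolution_power \<nu>) (simp add: mgf_convolution_power[OF \<nu>])
  then show "\<exists>\<nu>. real_distribution \<nu> \<and> (convolution \<nu> ^^ n) (return borel 0) = \<mu>"
    using moment_lawD(1)[OF \<nu>] by blast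
qed

text \<open>Weighting by \<open>x^2\<close> shifts the moments by two, the same shift as in
  \<open>fps_nth_integral_levy\<close>.\<close>

lemma square_density_law:
  assumes \<nu>: "moment_law \<nu>" and v: "(\<integral>x. x ^ 2 \<partial>\<nu>) = v" "0 < v"
  shows "moment_law (density \<nu> (\<lambda>x. ennreal (x\<^sup>2 / v)))"
    and "(\<integral>x. x ^ k \<partial>density \<nu> (\<lambda>x. ennreal (x\<^sup>2 / v))) = (\<integral>x. x ^ (k + 2) \<partial>\<nu>) / v"
proof -
  interpret real_distribution \<nu> using \<nu> by (rule moment_lawD)
  have i: "integrable \<nu> (\<lambda>x. x\<^sup>2 / v)" using moment_lawD(4)[OF \<nu>, of 2] by simp
  have "emeasure (density \<nu> (\<lambda>x. ennreal (x\<^sup>2 / v))) (space \<nu>) = (\<integral>\<^sup>+x. ennreal (x\<^sup>2 / v) \<partial>\<nu>)"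
    by (subst emeasure_density) (auto simp: indicator_def)
  also have "\<dots> = ennreal (\<integral>x. x\<^sup>2 / v \<partial>\<nu>)"
    using v by (intro nn_integral_eq_integral i) auto
  also have "\<dots> = 1" using v by simp
  finally have "prob_space (density \<nu> (\<lambda>x. ennreal (x\<^sup>2 / v)))"
    by (intro prob_spaceI) simp
  then have 1: "real_distribution (density \<nu> (\<lambda>x. ennreal (x\<^sup>2 / v)))"
    by (simp add: real_distribution_def real_distribution_axioms_def)
  have eq: "x\<^sup>2 / v * x ^ k = x ^ (k + 2) / v" for x k by (simp add: power_add power2_eq_square)
  have "integrable (density \<nu> (\<lambda>x. ennreal (x\<^sup>2 / v))) (\<lambda>x. x ^ k)" for k
    using v moment_lawD(4)[OF \<nu>, of "k + 2"]
    by (subst integrable_density) (auto simp: eq simp del: times_divide_eq_left)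
  with 1 show "moment_law (density \<nu> (\<lambda>x. ennreal (x\<^sup>2 / v)))"
    by (simp add: moment_law_def finite_moments_def)
  show "(\<integral>x. x ^ k \<partial>density \<nu> (\<lambda>x. ennreal (x\<^sup>2 / v))) = (\<integral>x. x ^ (k + 2) \<partial>\<nu>) / v"
    using v by (subst integral_density) (auto simp: eq simp del: times_divide_eq_left)
qed

text \<open>The Kolmogorov measure is the limit of the normalised measures \<open>x\<^sup>2 \<nu>\<^sub>n(dx)\<close> for the
  \<open>n\<close>-th convolution roots \<open>\<nu>\<^sub>n\<close>.\<close>

lemma kolmogorov_measure_exists:
  fixes L :: "real fps"
  assumes roots: "\<And>n. 0 < n \<Longrightarrow> \<exists>\<nu>. moment_law \<nu> \<and> fps_deriv (mgf_fps \<nu>) = (fps_const (1 / real n) * L) * mgf_fps \<nu>"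
    and L: "fps_nth L 0 = 0" "0 < fps_nth L 1"
  obtains \<chi>' where "moment_law \<chi>'" "\<And>k. (\<integral>x. x ^ k \<partial>\<chi>') = fact (k + 1) * fps_nth L (k + 1) / fps_nth L 1"
proof -
  obtain \<nu> where \<nu>: "\<And>n. moment_law (\<nu> n)"
    "\<And>n. fps_deriv (mgf_fps (\<nu> n)) = (fps_const (1 / real (Suc n)) * L) * mgf_fps (\<nu> n)"
    using roots[of "Suc _"] by (metis zero_less_Suc)
  have c0: "fps_nth (mgf_fps (\<nu> n)) 0 = 1" for n
    by (rule mgf_nth_0[OF moment_lawD(3)[OF \<nu>(1)]])
  \<comment> \<open>The log-derivatives \<open>L / (n + 1)\<close> tend to 0, so in terms of moments
    the roots degenerate to the point mass at 0.\<close>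
  have one: "(\<lambda>n. fps_nth (mgf_fps (\<nu> n)) k) \<longlonglongrightarrow> fps_nth 1 k" for k
  proof (rule fps_linear_ode_limit[OF \<nu>(2)])
    show "fps_deriv (1 :: real fps) = 0 * 1" by simp
    show "(\<lambda>n. fps_nth (fps_const (1 / real (Suc n)) * L) i) \<longlonglongrightarrow> fps_nth 0 i" for i
      using tendsto_mult_right[OF LIMSEQ_inverse_real_of_nat, of "fps_nth L i"]
      by (simp add: inverse_eq_divide)
  qed (simp add: c0)
  have coeff: "fps_nth (mgf_fps (\<nu> n)) (Suc k) = fps_nth (L * mgf_fps (\<nu> n)) k / (real (Suc n) * real (Suc k))" for n k
  proof -
    have "real (Suc k) * fps_nth (mgf_fps (\<nu> n)) (Suc k) = fps_nth (fps_const (1 / real (Suc n)) * (L * mgf_fps (\<nu> n))) k"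
      using \<nu>(2)[of n] by (metis fps_deriv_nth Suc_eq_plus1 mult.assoc)
    also have "\<dots> = fps_nth (L * mgf_fps (\<nu> n)) k / real (Suc n)" by simp
    finally show ?thesis by (simp add: field_simps del: of_nat_Suc)
  qed
  \<comment> \<open>Because the first cumulant is 0, the second moment of each root is exactly the
    second cumulant divided by \<open>n + 1\<close>; this is the normalising constant
    \<open>v n\<close>.\<close>
  have L1: "fps_nth (L * mgf_fps (\<nu> n)) (Suc 0) = fps_nth L 1" for n
    by (simp add: fps_mult_nth L(1) c0)
  define v where "v n = fps_nth L 1 / real (Suc n)" for n
  have v: "0 < v n" for n using L by (simp add: v_def)
  have var: "(\<integral>x. x ^ 2 \<partial>\<nu> n) = v n" for n
    unfolding moment_mgf numeral_2_eq_2 coeff L1 by (simp add: v_def field_simps del: of_nat_Suc)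
  define N where "N n = density (\<nu> n) (\<lambda>x. ennreal (x\<^sup>2 / v n))" for n
  have N: "moment_law (N n)" for n
    unfolding N_def by (rule square_density_law(1)[OF \<nu>(1) var v])
  have "(\<integral>x. x ^ k \<partial>N n) = fact (k + 1) / fps_nth L 1 * fps_nth (L * mgf_fps (\<nu> n)) (Suc k)" for n k
  proof -
    have "(\<integral>x. x ^ k \<partial>N n) = fact (Suc (Suc k)) * fps_nth (mgf_fps (\<nu> n)) (Suc (Suc k)) / v n"
      unfolding N_def square_density_law(2)[OF \<nu>(1) var v] moment_mgf[where M = "\<nu> n"] by (simp del: fact_Suc)
    also have "\<dots> = fact (k + 1) / fps_nth L 1 * fps_nth (L * mgf_fps (\<nu> n)) (Suc k)"
      unfolding coeff v_def fact_Suc[of "Suc k"] using L by (simp add: field_simps del: of_nat_Suc fact_Suc)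
    finally show ?thesis .
  qed
  moreover have "(\<lambda>n. fact (k + 1) / fps_nth L 1 * fps_nth (L * mgf_fps (\<nu> n)) (Suc k)) \<longlonglongrightarrow>
      fact (k + 1) / fps_nth L 1 * fps_nth (L * 1) (Suc k)" for k
    unfolding fps_mult_nth[of L] by (intro tendsto_intros one)
  ultimately have "(\<lambda>n. \<integral>x. x ^ k \<partial>N n) \<longlonglongrightarrow> fact (k + 1) / fps_nth L 1 * fps_nth (L * 1) (Suc k)" for k
    by simp
  from method_of_moments[OF N this] obtain \<chi>' where \<chi>': "moment_law \<chi>'"
    "\<And>k. (\<integral>x. x ^ k \<partial>\<chi>') = fact (k + 1) / fps_nth L 1 * fps_nth (L * 1) (Suc k)"
    by blast
  show ?thesis by (rule that[OF \<chi>'(1)]) (simp add: \<chi>'(2))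
qed

section \<open>Innovations of the process\<close>

lemma sigma_finite_subalgebra_sigma_past:
  assumes "prob_space M" "\<And>t. X t \<in> borel_measurable M"
  shows "sigma_finite_subalgebra M (sigma_past M X s)"
proof -
  interpret prob_space M by fact
  let ?G = "{X r -` B \<inter> space M | r B. r \<le> s \<and> B \<in> sets borel}"
  have "?G \<subseteq> sets M" using assms(2) by (auto intro: measurable_sets)
  then have "subalgebra M (sigma_past M X s)"
    unfolding subalgebra_def sigma_past_def
    by (auto simp: space_measure_of_conv sets_measure_of_conv intro: sets.sigma_sets_subset[THEN subsetD])
  then have "finite_measure_subalgebra M (sigma_past M X s)"
    by (intro finite_measure_subalgebra.intro finite_measure_axioms finite_measure_subalgebra_axioms.intro)
  then show ?thesis by (rule finite_measure_subalgebra_is_sigma_finite)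
qed

lemma measurable_sigma_past:
  assumes "r \<le> s"
  shows "X r \<in> borel_measurable (sigma_past M X s)"
proof (rule measurableI)
  let ?G = "{X r -` B \<inter> space M | r B. r \<le> s \<and> B \<in> sets borel}"
  have G: "?G \<subseteq> Pow (space M)" by auto
  have sp: "space (sigma_past M X s) = space M"
    unfolding sigma_past_def by (rule space_measure_of[OF G])
  fix B :: "real set" assume "B \<in> sets borel"
  then have "X r -` B \<inter> space M \<in> ?G" using assms by blast
  then show "X r -` B \<inter> space (sigma_past M X s) \<in> sets (sigma_past M X s)"
    unfolding sp unfolding sigma_past_def sets_measure_of[OF G] by (rule sigma_sets.Basic)
qed auto

text \<open>A polynomial that vanishes almost surely forces a finite support \<open>S\<close>. For almost every value
  \<open>y\<close> of the innovation, \<open>x \<mapsto> a x + y\<close> maps \<open>S\<close> injectively into itself, hence onto itself, which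
  is impossible for \<open>\<bar>a\<bar> < 1\<close> unless \<open>S\<close> is a single point.\<close>

lemma selfdecomposable_finite_support:
  assumes \<mu>: "real_distribution \<mu>" and Y: "real_distribution Y"
    and conv: "\<mu> = (distr \<mu> borel ((*) a) \<star> Y)" and a: "0 < a" "a < 1"
    and p: "p \<noteq> 0" "AE x in \<mu>. poly p x = 0"
  obtains c where "AE x in \<mu>. x = c"
proof -
  interpret \<mu>: real_distribution \<mu> by fact
  interpret Y: real_distribution Y by fact
  have ma: "(*) a \<in> borel_measurable \<mu>" by measurable
  interpret A: prob_space "distr \<mu> borel ((*) a)" by (rule \<mu>.prob_space_distr[OF ma])
  interpret P: pair_prob_space "distr \<mu> borel ((*) a)" Y ..
  \<comment> \<open>Roots of \<open>p\<close> without mass are set aside, so that every point of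
    \<open>S\<close> is an atom of \<open>\<mu>\<close>.\<close>
  define S where "S = {x. poly p x = 0 \<and> emeasure \<mu> {x} \<noteq> 0}"
  define T where "T = {x. poly p x = 0 \<and> emeasure \<mu> {x} = 0}"
  have fin: "finite S" "finite T"
    using poly_roots_finite[OF p(1)] by (auto simp: S_def T_def)
  have "AE x in \<mu>. \<forall>y\<in>T. x \<noteq> y"
    unfolding AE_finite_all[OF fin(2)]
  proof
    fix y assume "y \<in> T"
    then have "{y} \<in> null_sets \<mu>" by (simp add: T_def null_sets_def)
    then show "AE x in \<mu>. x \<noteq> y" using AE_not_in by fastforce
  qed
  with p(2) have S: "AE x in \<mu>. x \<in> S" by eventually_elim (auto simp: S_def T_def)
  have "AE z in distr (distr \<mu> borel ((*) a) \<Otimes>\<^sub>M Y) borel (\<lambda>(x, y). x + y). z \<in> S"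
    using S unfolding convolution_def[symmetric] conv[symmetric] .
  then have "AE z in (distr \<mu> borel ((*) a) \<Otimes>\<^sub>M Y). (\<lambda>(x, y). x + y) z \<in> S"
    by (rule AE_distrD[rotated]) measurable
  then have "AE x in distr \<mu> borel ((*) a). AE y in Y. (\<lambda>(x, y). x + y) (x, y) \<in> S"
    by (rule P.AE_pair)
  then have ae: "AE x in \<mu>. AE y in Y. a * x + y \<in> S"
    using AE_distrD[OF ma, of "\<lambda>x. AE y in Y. x + y \<in> S"] by simp
  \<comment> \<open>What holds almost surely under \<open>\<mu>\<close> holds at each atom.
    Finiteness of \<open>S\<close> then provides one \<open>y\<close> that serves all
    \<open>x\<close> in \<open>S\<close> at once.\<close>
  have atom: "AE y in Y. a * x + y \<in> S" if "x \<in> S" for x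
  proof (rule ccontr)
    assume n: "\<not> (AE y in Y. a * x + y \<in> S)"
    have "AE z in \<mu>. z \<noteq> x" using ae by eventually_elim (use n in auto)
    then have "emeasure \<mu> {x} = 0"
      by (subst (asm) AE_iff_measurable[where N = "{x}"]) auto
    then show False using that by (simp add: S_def)
  qed
  then have "AE y in Y. \<forall>x\<in>S. a * x + y \<in> S"
    by (subst AE_finite_all[OF fin(1)]) blast
  then obtain y where y: "\<forall>x\<in>S. a * x + y \<in> S"
    using eventually_happens'[of "ae_filter Y"] Y.emeasure_space_1 by (auto simp: ae_filter_eq_bot_iff)
  from S obtain s where s: "s \<in> S"
    using eventually_happens'[of "ae_filter \<mu>"] \<mu>.emeasure_space_1 by (auto simp: ae_filter_eq_bot_iff)
  have onto: "(\<lambda>x. a * x + y) ` S = S"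
    using y a(1) by (intro endo_inj_surj fin) (auto simp: inj_on_def)
  \<comment> \<open>An increasing affine bijection of a finite set fixes its largest and its
    smallest element, but slope \<open>a < 1\<close> allows a single fixed point.\<close>
  have mx: "Max S = a * Max S + y"
  proof (rule antisym)
    have "Max S \<in> S" using fin s by (intro Max_in) auto
    then obtain x where x: "x \<in> S" "Max S = a * x + y" using onto by blast
    have "a * x \<le> a * Max S" using x(1) a fin by (intro mult_left_mono) auto
    then show "Max S \<le> a * Max S + y" using x(2) by linarith
    show "a * Max S + y \<le> Max S" using \<open>Max S \<in> S\<close> y fin by (intro Max_ge) auto
  qed
  have mn: "Min S = a * Min S + y"
  proof (rule antisym)
    have "Min S \<in> S" using fin s by (intro Min_in) auto
    then obtain x where x: "x \<in> S" "Min S = a * x + y" using onto by blast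
    have "a * Min S \<le> a * x" using x(1) a fin by (intro mult_left_mono) auto
    then show "a * Min S + y \<le> Min S" using x(2) by linarith
    show "Min S \<le> a * Min S + y" using \<open>Min S \<in> S\<close> y fin by (intro Min_le) auto
  qed
  have "(1 - a) * (Max S - Min S) = 0" using mx mn by (simp add: algebra_simps)
  then have eq: "Max S = Min S" using a by simp
  have "AE x in \<mu>. x = Max S"
    using S
  proof eventually_elim
    fix x assume "x \<in> S"
    then have "x \<le> Max S" "Min S \<le> x" using fin by auto
    then show "x = Max S" using eq by simp
  qed
  then show ?thesis by (rule that)
qed

section \<open>Independence of innovations and past at the level of moments\<close>

locale independent_innovations = prob_space M
  for M :: "'a measure" and X :: "real \<Rightarrow> 'a \<Rightarrow> real" +
  assumes measurable_X [measurable]: "X t \<in> borel_measurable M"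
    and law_X: "distr M borel (X t) = distr M borel (X 0)"
    and moments_0: "finite_moments (distr M borel (X 0))"
    and regression: "s < t \<Longrightarrow>
      AE \<omega> in M. real_cond_exp M (sigma_past M X s) (X t) \<omega> = exp (- (t - s)) * X s \<omega>"
    and indep_regression: "independent_regression M X"
begin

abbreviation \<mu> :: "real measure" where "\<mu> \<equiv> distr M borel (X 0)"

lemma integral_law: "f \<in> borel_measurable borel \<Longrightarrow> (\<integral>\<omega>. f (X t \<omega>) \<partial>M) = (\<integral>x. f x \<partial>\<mu>)"
  for f :: "real \<Rightarrow> real"
  by (subst law_X[of t, symmetric]) (simp add: integral_distr)

lemma integral_power: "(\<integral>\<omega>. X t \<omega> ^ n \<partial>M) = (\<integral>x. x ^ n \<partial>\<mu>)"
  by (rule integral_law) simp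

lemma integrable_power: "integrable M (\<lambda>\<omega>. X t \<omega> ^ n)"
proof -
  have "integrable (distr M borel (X t)) (\<lambda>x. x ^ n)"
    unfolding law_X[of t] using moments_0 by (simp add: finite_moments_def)
  then show ?thesis by (simp add: integrable_distr_eq)
qed

lemma moment_law_\<mu>: "moment_law \<mu>"
  using moments_0 real_distribution_distr[OF measurable_X] by (simp add: moment_law_def)

lemma integrable_monom: "integrable M (\<lambda>\<omega>. X s \<omega> ^ i * X t \<omega> ^ j)"
proof (rule Bochner_Integration.integrable_bound)
  show "integrable M (\<lambda>\<omega>. X s \<omega> ^ (2 * i) + X t \<omega> ^ (2 * j))"
    by (intro Bochner_Integration.integrable_add integrable_power)
  have b: "\<bar>x * y\<bar> \<le> \<bar>x\<^sup>2 + y\<^sup>2\<bar>" for x y :: real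
  proof -
    have "0 \<le> (\<bar>x\<bar> - \<bar>y\<bar>)\<^sup>2" by simp
    then have "2 * (\<bar>x\<bar> * \<bar>y\<bar>) \<le> x\<^sup>2 + y\<^sup>2" by (simp add: power2_diff)
    moreover have "0 \<le> \<bar>x\<bar> * \<bar>y\<bar>" by simp
    ultimately have "\<bar>x\<bar> * \<bar>y\<bar> \<le> x\<^sup>2 + y\<^sup>2" by linarith
    then show ?thesis by (simp add: abs_mult)
  qed
  show "AE \<omega> in M. norm (X s \<omega> ^ i * X t \<omega> ^ j) \<le> norm (X s \<omega> ^ (2 * i) + X t \<omega> ^ (2 * j))"
    using b[of "X s _ ^ i" "X t _ ^ j"] by (simp add: power_mult[symmetric] mult.commute[of _ 2])
qed measurable

definition innovation :: "real \<Rightarrow> real \<Rightarrow> 'a \<Rightarrow> real" where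
  "innovation s t \<omega> = X t \<omega> - exp (- (t - s)) * X s \<omega>"

lemma measurable_innovation [measurable]: "innovation s t \<in> borel_measurable M"
  unfolding innovation_def[abs_def] by measurable

lemma integrable_innovation: "integrable M (\<lambda>\<omega>. X s \<omega> ^ i * innovation s t \<omega> ^ j)"
proof -
  define c where "c = - exp (- (t - s))"
  have "X s \<omega> ^ i * innovation s t \<omega> ^ j =
      (\<Sum>k\<le>j. real (j choose k) * c ^ (j - k) * (X s \<omega> ^ (i + (j - k)) * X t \<omega> ^ k))" for \<omega>
  proof -
    have "innovation s t \<omega> ^ j = (X t \<omega> + c * X s \<omega>) ^ j"
      by (simp add: innovation_def c_def)
    also have "\<dots> = (\<Sum>k\<le>j. real (j choose k) * X t \<omega> ^ k * (c * X s \<omega>) ^ (j - k))"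
      by (rule binomial_ring)
    finally show ?thesis
      by (simp only: sum_distrib_left power_mult_distrib power_add mult_ac)
  qed
  then show ?thesis by (simp add: integrable_monom)
qed

lemma integrable_innovation_power: "integrable M (\<lambda>\<omega>. innovation s t \<omega> ^ j)"
  using integrable_innovation[of s 0 t j] by simp

text \<open>The non-random value granted by independent regression must be the mean, as expectations
  show. That property is stated around the conditional expectation itself, which
  \<open>regression\<close> replaces by a multiple of \<open>X s\<close>; order 0 lies outside it
  and is treated apart.\<close>

lemma cond_exp_innovation:
  assumes st: "s < t"
  shows "AE \<omega> in M. real_cond_exp M (sigma_past M X s) (\<lambda>\<omega>. innovation s t \<omega> ^ j) \<omega> =
    (\<integral>\<omega>. innovation s t \<omega> ^ j \<partial>M)"
proof -
  interpret F: sigma_finite_subalgebra M "sigma_past M X s"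
    by (rule sigma_finite_subalgebra_sigma_past[OF prob_space_axioms measurable_X])
  obtain c where c: "AE \<omega> in M. real_cond_exp M (sigma_past M X s) (\<lambda>\<omega>. innovation s t \<omega> ^ j) \<omega> = c"
  proof (cases "j = 0")
    case True
    have "AE \<omega> in M. real_cond_exp M (sigma_past M X s) (\<lambda>\<omega>. 1) \<omega> = 1"
      by (rule F.real_cond_exp_F_meas) auto
    then show ?thesis using that[of 1] True by simp
  next
    case False
    then obtain c where c: "AE \<omega> in M. real_cond_exp M (sigma_past M X s)
        (\<lambda>\<omega>. (X t \<omega> - real_cond_exp M (sigma_past M X s) (X t) \<omega>) ^ j) \<omega> = c"
      using indep_regression st unfolding independent_regression_def by (metis One_nat_def Suc_leI neq0_conv)
    have "AE \<omega> in M. (X t \<omega> - real_cond_exp M (sigma_past M X s) (X t) \<omega>) ^ j = innovation s t \<omega> ^ j"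
      using regression[OF st] by eventually_elim (simp add: innovation_def)
    from F.real_cond_exp_cong[OF this] c
    show ?thesis by (intro that[of c]) (auto elim: AE_mp)
  qed
  have "(\<integral>\<omega>. innovation s t \<omega> ^ j \<partial>M) =
      (\<integral>\<omega>. real_cond_exp M (sigma_past M X s) (\<lambda>\<omega>. innovation s t \<omega> ^ j) \<omega> \<partial>M)"
    by (rule F.real_cond_exp_int(2)[OF integrable_innovation_power, symmetric])
  also have "\<dots> = (\<integral>\<omega>. c \<partial>M)" using c by (intro integral_cong_AE) auto
  also have "\<dots> = c" by (simp add: prob_space)
  finally show ?thesis using c by simp
qed

text \<open>Powers of \<open>X s\<close> are measurable with respect to the past and can be pulled
  out. Only mixed moments factor here; genuine independence is neither claimed nor available at this
  point.\<close>

lemma integral_power_innovation: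
  assumes st: "s < t"
  shows "(\<integral>\<omega>. X s \<omega> ^ i * innovation s t \<omega> ^ j \<partial>M) =
    (\<integral>\<omega>. X s \<omega> ^ i \<partial>M) * (\<integral>\<omega>. innovation s t \<omega> ^ j \<partial>M)"
proof -
  interpret F: sigma_finite_subalgebra M "sigma_past M X s"
    by (rule sigma_finite_subalgebra_sigma_past[OF prob_space_axioms measurable_X])
  have [measurable]: "X s \<in> borel_measurable (sigma_past M X s)"
    by (rule measurable_sigma_past) simp
  have "(\<integral>\<omega>. X s \<omega> ^ i * innovation s t \<omega> ^ j \<partial>M) =
      (\<integral>\<omega>. X s \<omega> ^ i * real_cond_exp M (sigma_past M X s) (\<lambda>\<omega>. innovation s t \<omega> ^ j) \<omega> \<partial>M)"
    by (rule F.real_cond_exp_intg(2)[OF integrable_innovation, symmetric]) measurable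
  also have "\<dots> = (\<integral>\<omega>. X s \<omega> ^ i * (\<integral>\<omega>. innovation s t \<omega> ^ j \<partial>M) \<partial>M)"
    using cond_exp_innovation[OF st, of j] by (intro integral_cong_AE) auto
  finally show ?thesis by simp
qed

lemma power_eq_sum_innovation:
  "X t \<omega> ^ n = (\<Sum>k\<le>n. real (n choose k) * exp (- (t - s)) ^ k * (X s \<omega> ^ k * innovation s t \<omega> ^ (n - k)))"
proof -
  have "X t \<omega> ^ n = (exp (- (t - s)) * X s \<omega> + innovation s t \<omega>) ^ n"
    by (simp add: innovation_def)
  also have "\<dots> = (\<Sum>k\<le>n. real (n choose k) * (exp (- (t - s)) * X s \<omega>) ^ k * innovation s t \<omega> ^ (n - k))"
    by (rule binomial_ring)
  finally show ?thesis by (simp only: power_mult_distrib mult_ac)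
qed

definition innovation_law :: "real \<Rightarrow> real \<Rightarrow> real measure" where
  "innovation_law s t = distr M borel (innovation s t)"

lemma moment_law_innovation: "moment_law (innovation_law s t)"
  unfolding innovation_law_def
  by (intro moment_law_distr prob_space_axioms measurable_innovation integrable_innovation_power)

lemma innovation_moment: "(\<integral>\<omega>. innovation s t \<omega> ^ j \<partial>M) = fact j * fps_nth (mgf_fps (innovation_law s t)) j"
  unfolding moment_mgf[symmetric] innovation_law_def by (simp add: integral_distr)

text \<open>The binomial expansion of \<open>e^(-(t-s)) X_s\<close> plus the innovation, with mixed
  moments factored, is a Cauchy product after division by \<open>n!\<close>. By stationarity
  \<open>X s\<close> and \<open>X t\<close> contribute the same series.\<close>

lemma mgf_factorization:
  assumes st: "s < t"
  shows "mgf_fps \<mu> = (mgf_fps \<mu> oo (fps_const (exp (- (t - s))) * fps_X)) * mgf_fps (innovation_law s t)"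
proof (rule fps_ext)
  fix n
  have "(\<integral>x. x ^ n \<partial>\<mu>) = (\<integral>\<omega>. X t \<omega> ^ n \<partial>M)" by (rule integral_power[symmetric])
  also have "\<dots> = (\<Sum>k\<le>n. real (n choose k) * exp (- (t - s)) ^ k *
      ((\<integral>x. x ^ k \<partial>\<mu>) * (\<integral>\<omega>. innovation s t \<omega> ^ (n - k) \<partial>M)))"
    unfolding power_eq_sum_innovation[of t _ n s]
    by (simp add: integrable_innovation integral_power_innovation[OF st] integral_power)
  finally have "fps_nth (mgf_fps \<mu>) n = (\<Sum>k\<le>n. real (n choose k) * exp (- (t - s)) ^ k *
      ((\<integral>x. x ^ k \<partial>\<mu>) * (\<integral>\<omega>. innovation s t \<omega> ^ (n - k) \<partial>M))) / fact n"
    by (simp add: fps_nth_mgf)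
  also have "\<dots> = (\<Sum>k\<le>n. exp (- (t - s)) ^ k * fps_nth (mgf_fps \<mu>) k * fps_nth (mgf_fps (innovation_law s t)) (n - k))"
    unfolding sum_divide_distrib innovation_moment moment_mgf
    by (intro sum.cong) (auto simp: binomial_fact)
  finally show "fps_nth (mgf_fps \<mu>) n =
      fps_nth ((mgf_fps \<mu> oo (fps_const (exp (- (t - s))) * fps_X)) * mgf_fps (innovation_law s t)) n"
    unfolding fps_mult_nth fps_nth_scale atLeast0AtMost .
qed

text \<open>The conditional moment as the binomial theorem delivers it, with innovation moments in
  place of innovation powers. Its constant term is the \<open>n\<close>-th innovation moment, the
  quantity to be compared with \<open>Q\<close>.\<close>

definition regression_poly :: "real \<Rightarrow> real \<Rightarrow> nat \<Rightarrow> real poly" where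
  "regression_poly s t n = (\<Sum>k\<le>n. Polynomial.monom (real (n choose k) * exp (- (t - s)) ^ k *
     (\<integral>\<omega>. innovation s t \<omega> ^ (n - k) \<partial>M)) k)"

lemma coeff_regression_poly_0:
  "Polynomial.coeff (regression_poly s t n) 0 = fact n * fps_nth (mgf_fps (innovation_law s t)) n"
proof -
  have "Polynomial.coeff (regression_poly s t n) 0 =
      (\<Sum>k\<le>n. if k = 0 then (\<integral>\<omega>. innovation s t \<omega> ^ n \<partial>M) else 0)"
    unfolding regression_poly_def coeff_sum by (intro sum.cong) auto
  then show ?thesis by (simp add: innovation_moment)
qed

lemma cond_exp_power:
  assumes st: "s < t"
  shows "AE \<omega> in M. real_cond_exp M (sigma_past M X s) (\<lambda>\<omega>. X t \<omega> ^ n) \<omega> = poly (regression_poly s t n) (X s \<omega>)"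
proof -
  interpret F: sigma_finite_subalgebra M "sigma_past M X s"
    by (rule sigma_finite_subalgebra_sigma_past[OF prob_space_axioms measurable_X])
  have [measurable]: "X s \<in> borel_measurable (sigma_past M X s)"
    by (rule measurable_sigma_past) simp
  let ?f = "\<lambda>k \<omega>. (real (n choose k) * exp (- (t - s)) ^ k * X s \<omega> ^ k) * innovation s t \<omega> ^ (n - k)"
  have int: "integrable M (?f k)" for k
    using integrable_mult_right[OF integrable_innovation[of s k t "n - k"], of "real (n choose k) * exp (- (t - s)) ^ k"]
    by (simp add: mult.assoc)
  have "AE \<omega> in M. real_cond_exp M (sigma_past M X s) (\<lambda>\<omega>. \<Sum>k\<le>n. ?f k \<omega>) \<omega> =
      (\<Sum>k\<le>n. real_cond_exp M (sigma_past M X s) (?f k) \<omega>)"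
    by (rule F.real_cond_exp_sum[OF int])
  moreover have "AE \<omega> in M. \<forall>k\<in>{..n}. real_cond_exp M (sigma_past M X s) (?f k) \<omega> =
      real (n choose k) * exp (- (t - s)) ^ k * X s \<omega> ^ k * (\<integral>\<omega>. innovation s t \<omega> ^ (n - k) \<partial>M)"
    unfolding AE_finite_all[OF finite_atMost]
  proof
    fix k
    have "AE \<omega> in M. real_cond_exp M (sigma_past M X s) (?f k) \<omega> =
        real (n choose k) * exp (- (t - s)) ^ k * X s \<omega> ^ k *
        real_cond_exp M (sigma_past M X s) (\<lambda>\<omega>. innovation s t \<omega> ^ (n - k)) \<omega>"
      by (rule F.real_cond_exp_mult[OF _ _ int]) measurable
    then show "AE \<omega> in M. real_cond_exp M (sigma_past M X s) (?f k) \<omega> =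
      real (n choose k) * exp (- (t - s)) ^ k * X s \<omega> ^ k * (\<integral>\<omega>. innovation s t \<omega> ^ (n - k) \<partial>M)"
      using cond_exp_innovation[OF st, of "n - k"] by eventually_elim simp
  qed
  ultimately show ?thesis
  proof eventually_elim
    case (elim \<omega>)
    have "(\<lambda>\<omega>. X t \<omega> ^ n) = (\<lambda>\<omega>. \<Sum>k\<le>n. ?f k \<omega>)"
      using power_eq_sum_innovation[of t _ n s] by (simp add: mult.assoc)
    then have "real_cond_exp M (sigma_past M X s) (\<lambda>\<omega>. X t \<omega> ^ n) \<omega> =
        (\<Sum>k\<le>n. real_cond_exp M (sigma_past M X s) (?f k) \<omega>)"
      using elim(1) by simp
    also have "\<dots> = (\<Sum>k\<le>n. real (n choose k) * exp (- (t - s)) ^ k * X s \<omega> ^ k *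
        (\<integral>\<omega>. innovation s t \<omega> ^ (n - k) \<partial>M))"
      using elim(2) by (intro sum.cong) auto
    also have "\<dots> = poly (regression_poly s t n) (X s \<omega>)"
      unfolding regression_poly_def by (simp add: poly_sum poly_monom mult_ac)
    finally show ?case .
  qed
qed

end

text \<open>With \<open>g = 1 / f\<close>, the derivative of \<open>f(y) g(e^(-\<tau>) y)\<close> at
  \<open>\<tau> = 0\<close> is \<open>- y f(y) g'(y) = y f'(y) / f(y) = y L(y)\<close>; the factor
  \<open>y\<close> accounts for the index \<open>j - 1\<close>.\<close>

lemma constant_term_has_vector_derivative:
  fixes f L :: "real fps"
  assumes f: "fps_deriv f = L * f" "fps_nth f 0 = 1" and j: "0 < j"
  shows "((\<lambda>\<tau>. fps_nth (f * (inverse f oo (fps_const (exp (- \<tau>)) * fps_X))) j)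
     has_vector_derivative fps_nth L (j - 1)) (at_right 0)"
proof -
  define g where "g = inverse f"
  have fg: "f * g = 1" unfolding g_def by (rule inverse_mult_eq_1') (simp add: f(2))
  have "fps_deriv (f * g) = 0" unfolding fg by simp
  then have "f * (fps_deriv g + L * g) = 0" using f(1) by (simp add: algebra_simps)
  moreover have "f \<noteq> 0" using f(2) by auto
  ultimately have dg: "fps_deriv g = - (L * g)" by (simp add: eq_neg_iff_add_eq_0)
  have "f * (fps_X * fps_deriv g) = - (fps_X * L * (f * g))"
    unfolding dg by (simp add: mult_ac)
  then have eq: "f * (fps_X * fps_deriv g) = - (fps_X * L)" unfolding fg by simp
  have "((\<lambda>\<tau>. \<Sum>i\<le>j. fps_nth f i * (exp (- \<tau>) ^ (j - i) * fps_nth g (j - i))) has_real_derivative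
      (\<Sum>i\<le>j. fps_nth f i * (- (real (j - i) * fps_nth g (j - i))))) (at 0 within {0<..})"
  proof (intro DERIV_sum)
    fix i
    show "((\<lambda>\<tau>. fps_nth f i * (exp (- \<tau>) ^ (j - i) * fps_nth g (j - i))) has_real_derivative
        fps_nth f i * (- (real (j - i) * fps_nth g (j - i)))) (at 0 within {0<..})"
      by (auto intro!: derivative_eq_intros)
  qed
  also have "(\<lambda>\<tau>. \<Sum>i\<le>j. fps_nth f i * (exp (- \<tau>) ^ (j - i) * fps_nth g (j - i))) =
      (\<lambda>\<tau>. fps_nth (f * (g oo (fps_const (exp (- \<tau>)) * fps_X))) j)"
    unfolding fps_mult_nth fps_nth_scale atLeast0AtMost ..
  also have "(\<Sum>i\<le>j. fps_nth f i * (- (real (j - i) * fps_nth g (j - i)))) =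
      - fps_nth (f * (fps_X * fps_deriv g)) j"
  proof -
    have Xd: "fps_nth (fps_X * fps_deriv g) k = real k * fps_nth g k" for k
      by (cases k) (simp_all add: fps_X_mult_nth)
    show ?thesis unfolding fps_mult_nth[of f] atLeast0AtMost Xd by (simp add: sum_negf)
  qed
  also have "\<dots> = fps_nth L (j - 1)"
    unfolding eq using j by (simp add: fps_X_mult_nth)
  finally show ?thesis
    unfolding g_def by (simp add: has_real_derivative_iff_has_vector_derivative)
qed

text \<open>If no nonzero polynomial vanishes almost surely under \<open>\<mu>\<close>, then
  \<open>q\<close> is the explicit regression polynomial, and dividing the factorization by the
  dilated series exhibits its constant term. Otherwise \<open>q\<close> is not determined, but
  \<open>\<mu>\<close> is the point mass at 0 and both sides are 0.\<close>

lemma (in independent_innovations) constant_term_eq: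
  assumes ident: "identifiable_by_moments \<mu>" and centred: "(\<integral>\<omega>. X 0 \<omega> \<partial>M) = 0"
    and st: "s \<le> t" and j: "0 < j"
    and q: "AE \<omega> in M. real_cond_exp M (sigma_past M X s) (\<lambda>\<omega>. X t \<omega> ^ j) \<omega> = poly q (X s \<omega>)"
  shows "Polynomial.coeff q 0 = fact j *
    fps_nth (mgf_fps \<mu> * (inverse (mgf_fps \<mu>) oo (fps_const (exp (- (t - s))) * fps_X))) j"
proof -
  interpret F: sigma_finite_subalgebra M "sigma_past M X s"
    by (rule sigma_finite_subalgebra_sigma_past[OF prob_space_axioms measurable_X])
  let ?f = "mgf_fps \<mu>" and ?S = "fps_const (exp (- (t - s))) * fps_X :: real fps"
  have f0: "fps_nth ?f 0 = 1" by (rule mgf_nth_0[OF prob_space_distr]) measurable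
  have inv: "inverse ?f * ?f = 1" by (rule inverse_mult_eq_1) (simp add: f0)
  show ?thesis
  proof (cases "\<exists>p. p \<noteq> 0 \<and> (AE x in \<mu>. poly p x = 0)")
    case True
    then obtain p where p: "p \<noteq> 0" "AE x in \<mu>. poly p x = 0" by blast
    have lag: "0 < (1 :: real)" by simp
    \<comment> \<open>Lag 1 is an arbitrary choice. Identifiability lifts the factorization from
      series to measures, which the argument on supports requires.\<close>
    have "\<mu> = (distr \<mu> borel ((*) (exp (- (1 - 0)))) \<star> innovation_law 0 1)"
    proof (rule identifiable_mgf_eqI[OF ident, symmetric])
      show "moment_law (distr \<mu> borel ((*) (exp (- (1 - 0)))) \<star> innovation_law 0 1)"
        by (intro moment_law_convolution moment_law_scale moment_law_\<mu> moment_law_innovation)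
      show "mgf_fps (distr \<mu> borel ((*) (exp (- (1 - 0)))) \<star> innovation_law 0 1) = mgf_fps \<mu>"
        by (simp only: mgf_convolution[OF moment_law_scale[OF moment_law_\<mu>] moment_law_innovation]
            mgf_scale[OF moment_law_\<mu>] mgf_factorization[OF lag, symmetric])
    qed
    then obtain c where c: "AE x in \<mu>. x = c"
      by (rule selfdecomposable_finite_support[OF moment_lawD(1)[OF moment_law_\<mu>]
            moment_lawD(1)[OF moment_law_innovation] _ _ _ p]) auto
    have "(\<integral>x. x ^ 1 \<partial>\<mu>) = (\<integral>x. c \<partial>\<mu>)" using c by (intro integral_cong_AE) auto
    moreover have "(\<integral>x. x ^ 1 \<partial>\<mu>) = 0" using integral_power[of 0 1] centred by simp
    ultimately have "c = 0" using prob_space.prob_space[OF prob_space_distr[OF measurable_X]] by simp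
    with c have \<mu>0: "AE x in \<mu>. x = 0" by simp
    have Xz: "AE \<omega> in M. X r \<omega> = 0" for r
      using \<mu>0 by (subst (asm) law_X[of r, symmetric]) (rule AE_distrD[OF measurable_X])
    have m0: "(\<integral>x. x ^ k \<partial>\<mu>) = 0" if "0 < k" for k
    proof -
      have "(\<integral>x. x ^ k \<partial>\<mu>) = (\<integral>x. 0 \<partial>\<mu>)"
        using \<mu>0 that by (intro integral_cong_AE) auto
      then show ?thesis by simp
    qed
    have "?f = 1"
    proof (rule fps_ext)
      fix k show "fps_nth ?f k = fps_nth 1 k"
        using m0[of k] f0 by (cases k) (auto simp: fps_nth_mgf)
    qed
    moreover have "Polynomial.coeff q 0 = 0"
    proof -
      \<comment> \<open>As \<open>X s\<close> vanishes almost surely, only the constant term of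
        \<open>q\<close> is seen; taking expectations equates it with a moment of
        \<open>\<mu>\<close> of positive order.\<close>
      have "AE \<omega> in M. real_cond_exp M (sigma_past M X s) (\<lambda>\<omega>. X t \<omega> ^ j) \<omega> = Polynomial.coeff q 0"
        using q Xz[of s] by eventually_elim (simp add: poly_0_coeff_0)
      then have "(\<integral>\<omega>. real_cond_exp M (sigma_past M X s) (\<lambda>\<omega>. X t \<omega> ^ j) \<omega> \<partial>M) = (\<integral>\<omega>. Polynomial.coeff q 0 \<partial>M)"
        by (intro integral_cong_AE) auto
      also have "\<dots> = Polynomial.coeff q 0" by (simp add: prob_space)
      finally show ?thesis
        using F.real_cond_exp_int(2)[OF integrable_power] integral_power m0[OF j] by simp
    qed
    ultimately show ?thesis using j by simp
  next
    case False
    have unique: "q = r" if "AE \<omega> in M. real_cond_exp M (sigma_past M X s) (\<lambda>\<omega>. X t \<omega> ^ j) \<omega> = poly r (X s \<omega>)" for r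
    proof -
      have "AE \<omega> in M. poly (q - r) (X s \<omega>) = 0"
        using q that by eventually_elim simp
      moreover have [measurable]: "poly (q - r) \<in> borel_measurable borel"
        by (intro borel_measurable_continuous_onI continuous_intros)
      have "(AE x in distr M borel (X s). poly (q - r) x = 0) \<longleftrightarrow> (AE \<omega> in M. poly (q - r) (X s \<omega>) = 0)"
        by (rule AE_distr_iff) measurable
      ultimately have "AE x in distr M borel (X s). poly (q - r) x = 0" by simp
      then have "AE x in \<mu>. poly (q - r) x = 0" unfolding law_X[of s] .
      then have "q - r = 0" using False by blast
      then show ?thesis by simp
    qed
    show ?thesis
    \<comment> \<open>Lag 0 matters because the one-sided derivative at 0 involves the value of the
      constant term at 0; there the polynomial is \<open>x^j\<close>.\<close>
    proof (cases "s = t")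
      case True
      have "X s \<in> borel_measurable (sigma_past M X s)" by (rule measurable_sigma_past) simp
      then have "(\<lambda>\<omega>. X s \<omega> ^ j) \<in> borel_measurable (sigma_past M X s)" by (rule borel_measurable_power)
      then have "AE \<omega> in M. real_cond_exp M (sigma_past M X s) (\<lambda>\<omega>. X t \<omega> ^ j) \<omega> = poly (Polynomial.monom 1 j) (X s \<omega>)"
        using F.real_cond_exp_F_meas[OF integrable_power] True by (simp add: poly_monom)
      then have "q = Polynomial.monom 1 j" by (rule unique)
      moreover have "?f * (inverse ?f oo ?S) = 1"
        using True inv by (simp add: mult.commute)
      ultimately show ?thesis using j by simp
    next
      case False
      then have st: "s < t" using st by simp
      have q: "q = regression_poly s t j" by (rule unique[OF cond_exp_power[OF st]])
      have "?f * (inverse ?f oo ?S) = ((?f oo ?S) * mgf_fps (innovation_law s t)) * (inverse ?f oo ?S)"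
        by (simp only: mgf_factorization[OF st, symmetric])
      also have "\<dots> = ((inverse ?f * ?f) oo ?S) * mgf_fps (innovation_law s t)"
        by (simp add: fps_compose_mult_distrib mult_ac)
      also have "\<dots> = mgf_fps (innovation_law s t)" unfolding inv by simp
      finally show ?thesis unfolding q by (simp add: coeff_regression_poly_0)
    qed
  qed
qed

theorem lemma2:
  fixes M :: "'a measure"
    and X :: "real \<Rightarrow> 'a \<Rightarrow> real"
    and Q :: "nat \<Rightarrow> real \<Rightarrow> real poly"
    and d \<delta> :: "nat \<Rightarrow> real"
  assumes rsmpr: "rsmpr M X Q"
    and indep_regr: "independent_regression M X"
    and centred: "\<And>t. (\<integral>\<omega>. X t \<omega> \<partial>M) = 0"
    and time_scale: "\<And>s t. s < t \<Longrightarrow>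
      AE \<omega> in M. real_cond_exp M (sigma_past M X s) (X t) \<omega> = exp (- (t - s)) * X s \<omega>"
    and cond_moments: "\<And>j s t. 2 \<le> j \<Longrightarrow> s \<le> t \<Longrightarrow>
      AE \<omega> in M. real_cond_exp M (sigma_past M X s) (\<lambda>\<omega>. X t \<omega> ^ j) \<omega> =
                 poly (Q j (t - s)) (X s \<omega>)"
    and d: "\<And>j. 2 \<le> j \<Longrightarrow>
      d j = vector_derivative (\<lambda>\<tau>. Polynomial.coeff (Q j \<tau>) 0) (at_right 0)"
    and \<delta>: "\<And>j. 2 \<le> j \<Longrightarrow> \<delta> j = d j / real j"
  shows
    "(\<forall>j\<ge>2. ((\<lambda>\<tau>. Polynomial.coeff (Q j \<tau>) 0) has_vector_derivative d j) (at_right 0)) \<and>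
     infinitely_divisible (distr M borel (X 0)) \<and>
     mgf_fps (distr M borel (X 0)) =
       fps_compose (fps_exp 1) (Abs_fps (\<lambda>j. if 2 \<le> j then \<delta> j / fact j else 0)) \<and>
     (\<delta> 2 > 0 \<longrightarrow>
        (\<exists>\<nu>. real_distribution \<nu> \<and> identifiable_by_moments \<nu> \<and>
           (\<forall>j>2. \<delta> j / \<delta> 2 = (\<integral>x. x ^ (j - 2) \<partial>\<nu>)) \<and>
           mgf_fps (distr M borel (X 0)) =
             fps_compose (fps_exp 1) (fps_const (\<delta> 2) * integral_fps \<nu> levy_integrand))) \<and>
     (\<forall>s t. s < t \<longrightarrow>
        mgf_fps (distr M borel (\<lambda>\<omega>. X t \<omega> - exp (- (t - s)) * X s \<omega>)) =
          fps_compose (fps_exp 1)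
            (Abs_fps (\<lambda>j. if 2 \<le> j
               then \<delta> j * (1 - exp (- (real j * (t - s)))) / fact j else 0)))"
proof -
  have smpr: "smpr M X Q" using rsmpr by (simp add: rsmpr_def)
  then have ident: "identifiable_by_moments (distr M borel (X 0))"
    and proc: "real_process M X" and stat: "stationary_process M X"
    by (simp_all add: smpr_def)
  interpret prob_space M using proc by (simp add: real_process_def)
  interpret independent_innovations M X
  proof
    show "X t \<in> borel_measurable M" for t using proc by (simp add: real_process_def)
    show "distr M borel (X t) = distr M borel (X 0)" for t
      using stat by (simp add: stationary_process_def)
    show "finite_moments (distr M borel (X 0))"
      using ident by (simp add: identifiable_by_moments_def)
  qed (fact time_scale indep_regr)+
  have \<mu>: "prob_space \<mu>" by (rule prob_space_distr) measurable
  define f where "f = mgf_fps \<mu>"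
  define L where "L = fps_deriv f * inverse f"
  have f0: "fps_nth f 0 = 1" unfolding f_def by (rule mgf_nth_0[OF \<mu>])
  have f1: "fps_nth f (Suc 0) = 0"
    using integral_power[of 0 1] centred[of 0] by (simp add: f_def fps_nth_mgf)
  have ode: "fps_deriv f = L * f" unfolding L_def by (rule fps_log_deriv[OF f0])
  have L0: "fps_nth L 0 = 0" by (simp add: L_def f1)

  have has_deriv: "((\<lambda>\<tau>. Polynomial.coeff (Q j \<tau>) 0) has_vector_derivative fact j * fps_nth L (j - 1)) (at_right 0)"
    if j: "2 \<le> j" for j
  proof -
    have eq: "Polynomial.coeff (Q j \<tau>) 0 = fact j * fps_nth (f * (inverse f oo (fps_const (exp (- \<tau>)) * fps_X))) j"
      if "0 \<le> \<tau>" for \<tau>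
      using constant_term_eq[OF ident centred that _ cond_moments[OF j that]] j by (simp add: f_def)
    have "((\<lambda>\<tau>. fact j * fps_nth (f * (inverse f oo (fps_const (exp (- \<tau>)) * fps_X))) j)
        has_vector_derivative fact j * fps_nth L (j - 1)) (at_right 0)"
      using j by (intro has_vector_derivative_mult_right constant_term_has_vector_derivative ode f0) auto
    \<comment> \<open>Passing from \<open>at_right 0\<close> to \<open>at 0 within {0..}\<close>
      puts 0 into the set on which the two functions are compared, so that their values at lag 0 are
      matched as well.\<close>
    then show ?thesis
      unfolding at_within_Ici_at_right[symmetric]
      by (rule has_vector_derivative_transform_within[where d = 1]) (auto simp: eq)
  qed
  have d_eq: "d j = fact j * fps_nth L (j - 1)" if "2 \<le> j" for j
    unfolding d[OF that]
    by (rule vector_derivative_within[OF _ has_deriv[OF that]]) simp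
  \<comment> \<open>This says that \<open>\<delta> j\<close> is the \<open>j\<close>-th cumulant:
    \<open>L\<close> is the derivative of the logarithm of \<open>f\<close>, and the division of
    \<open>d j\<close> by \<open>j\<close> turns \<open>j!\<close> into
    \<open>(j - 1)!\<close>.\<close>
  have \<delta>_eq: "\<delta> j = fact (j - 1) * fps_nth L (j - 1)" if "2 \<le> j" for j
    using that unfolding \<delta>[OF that] d_eq[OF that] by (subst fact_reduce) auto
  define K where "K = Abs_fps (\<lambda>j. if 2 \<le> j then \<delta> j / fact j else 0)"
  \<comment> \<open>\<open>K\<close> is the antiderivative of \<open>L\<close>. It starts at order 2
    because centring makes \<open>fps_nth L 0\<close> vanish.\<close>
  have K_nth: "fps_nth K (Suc i) = fps_nth L i / real (Suc i)" for i
  proof (cases i)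
    case (Suc k)
    have "fps_nth K (Suc i) = fact (Suc k) * fps_nth L (Suc k) / fact (Suc (Suc k))"
      using Suc by (simp add: K_def \<delta>_eq del: fact_Suc)
    then show ?thesis
      unfolding Suc fact_Suc[of "Suc k"] by (simp del: fact_Suc of_nat_Suc)
  qed (simp add: K_def L0)
  have mgf: "f = fps_exp 1 oo K"
  proof (rule fps_exp_compose_eqI[OF f0])
    have "fps_deriv K = L" by (rule fps_ext) (simp add: K_nth del: of_nat_Suc)
    then show "fps_deriv f = fps_deriv K * f" using ode by simp
  qed (simp add: K_def)

  have roots: "\<exists>\<nu>. moment_law \<nu> \<and> fps_deriv (mgf_fps \<nu>) = (fps_const (1 / real n) * L) * mgf_fps \<nu>"
    if n: "0 < n" for n
  proof (rule selfdecomposable_root[OF \<mu> ode[unfolded f_def] _ n])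
    fix \<tau> :: real assume "0 < \<tau>"
    then show "\<exists>Y. moment_law Y \<and> mgf_fps \<mu> = (mgf_fps \<mu> oo (fps_const (exp (- \<tau>)) * fps_X)) * mgf_fps Y"
      using moment_law_innovation[of 0 \<tau>] mgf_factorization[of 0 \<tau>] by auto
  qed blast
  have inf_div: "infinitely_divisible \<mu>"
    by (rule infinitely_divisible_if_roots[OF ident \<mu> ode[unfolded f_def] roots])

  have kolmogorov: "\<exists>\<nu>. real_distribution \<nu> \<and> identifiable_by_moments \<nu> \<and>
      (\<forall>j>2. \<delta> j / \<delta> 2 = (\<integral>x. x ^ (j - 2) \<partial>\<nu>)) \<and>
      f = fps_exp 1 oo (fps_const (\<delta> 2) * integral_fps \<nu> levy_integrand)" if pos: "0 < \<delta> 2"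
  proof -
    have L1: "\<delta> 2 = fps_nth L 1" by (simp add: \<delta>_eq)
    obtain \<nu> where \<nu>: "moment_law \<nu>"
      "\<And>k. (\<integral>x. x ^ k \<partial>\<nu>) = fact (k + 1) * fps_nth L (k + 1) / fps_nth L 1"
      using kolmogorov_measure_exists[OF roots L0] pos L1 by auto
    have m: "(\<integral>x. x ^ (j - 2) \<partial>\<nu>) = \<delta> j / \<delta> 2" if "2 \<le> j" for j
    proof -
      from that have "j - 2 + 1 = j - 1" by simp
      then show ?thesis unfolding \<nu>(2) \<delta>_eq[OF that] L1 by simp
    qed
    have "fps_const (\<delta> 2) * integral_fps \<nu> levy_integrand = K"
      using pos by (intro fps_ext) (simp add: fps_nth_integral_levy m K_def)
    with mgf have rep: "f = fps_exp 1 oo (fps_const (\<delta> 2) * integral_fps \<nu> levy_integrand)" by simp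
    moreover have "identifiable_by_moments \<nu>"
      by (rule identifiable_levy_measure[OF ident \<nu>(1) pos rep[unfolded f_def]])
    ultimately show ?thesis using \<nu>(1) m by (intro exI[of _ \<nu>]) (auto intro: moment_lawD)
  qed

  have innov: "mgf_fps (innovation_law s t) = fps_exp 1 oo
      (Abs_fps (\<lambda>j. if 2 \<le> j then \<delta> j * (1 - exp (- (real j * (t - s)))) / fact j else 0))"
    (is "_ = fps_exp 1 oo ?J") if st: "s < t" for s t
  proof (rule fps_exp_compose_eqI)
    show "fps_nth (mgf_fps (innovation_law s t)) 0 = 1"
      by (rule mgf_nth_0[OF moment_lawD(3)[OF moment_law_innovation]])
    \<comment> \<open>The exponent is \<open>K(y) - K(e^(-(t-s)) y)\<close>, the logarithm of the
      quotient of the series of \<open>\<mu>\<close> and its dilation.\<close>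
    have J: "?J = Abs_fps (\<lambda>j. fps_nth K j * (1 - exp (- (t - s)) ^ j))"
    proof (rule fps_ext)
      fix j
      have pow: "exp (- (t - s)) ^ j = exp (- (real j * (t - s)))"
        unfolding exp_of_nat_mult[symmetric] by (simp add: algebra_simps)
      show "fps_nth ?J j = fps_nth (Abs_fps (\<lambda>j. fps_nth K j * (1 - exp (- (t - s)) ^ j))) j"
        unfolding K_def fps_nth_Abs_fps pow by simp
    qed
    have "fps_deriv ?J = Abs_fps (\<lambda>i. (1 - exp (- (t - s)) ^ Suc i) * fps_nth L i)"
      unfolding J by (rule fps_ext) (simp add: K_nth del: of_nat_Suc power_Suc)
    then show "fps_deriv (mgf_fps (innovation_law s t)) = fps_deriv ?J * mgf_fps (innovation_law s t)"
      using selfdecomposition_ode[OF ode f0 mgf_factorization[OF st, folded f_def]] by simp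
  qed simp

  show ?thesis
  proof (intro conjI allI impI)
    show "((\<lambda>\<tau>. Polynomial.coeff (Q j \<tau>) 0) has_vector_derivative d j) (at_right 0)" if "2 \<le> j" for j
      using has_deriv[OF that] d_eq[OF that] by simp
    show "infinitely_divisible \<mu>" by (rule inf_div)
    show "mgf_fps \<mu> = fps_exp 1 oo Abs_fps (\<lambda>j. if 2 \<le> j then \<delta> j / fact j else 0)"
      using mgf unfolding f_def K_def .
    show "\<exists>\<nu>. real_distribution \<nu> \<and> identifiable_by_moments \<nu> \<and>
        (\<forall>j>2. \<delta> j / \<delta> 2 = (\<integral>x. x ^ (j - 2) \<partial>\<nu>)) \<and>
        mgf_fps \<mu> = fps_exp 1 oo (fps_const (\<delta> 2) * integral_fps \<nu> levy_integrand)" if "0 < \<delta> 2"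
      using kolmogorov[OF that] unfolding f_def .
    show "mgf_fps (distr M borel (\<lambda>\<omega>. X t \<omega> - exp (- (t - s)) * X s \<omega>)) = fps_exp 1 oo
        Abs_fps (\<lambda>j. if 2 \<le> j then \<delta> j * (1 - exp (- (real j * (t - s)))) / fact j else 0)"
      if "s < t" for s t
      using innov[OF that] unfolding innovation_law_def innovation_def[abs_def] .
  qed
qed

end
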